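(* There exists a sofic $\mathbb Z^2$-shift with positive entropy whose only nonempty SFT subsystem is a singleton.
   Context: For a finite set $\mathcal A$ (alphabet, discrete topology), $\mathcal A^{\mathbb Z^2}$ carries the product topology and the $\mathbb Z^2$-action $(\sigma^g x)_h = x_{h+g}$ for $g,h\in\mathbb Z^2$. A subshift ($\mathbb Z^2$-shift) is a closed subset $X\subset \mathcal A^{\mathbb Z^2}$ with $\sigma^g x\in X$ for all $x\in X$, $g\in \mathbb Z^2$. A subsystem of a subshift is a subshift contained in it. A pattern is a function $p:F\to\mathcal A$ with $F\subset \mathbb Z^2$ finite; it occurs in $x$ if $(\sigma^g x)|_F = p$ for some $g$. $X\subset\mathcal A^{\mathbb Z^2}$ is a shift of finite type (SFT) if there is a finite collection $\mathcal F$ of patterns such that $X$ is the set of all $x\in\mathcal A^{\mathbb Z^2}$ in which no $p\in\mathcal F$ occurs. A factor map between subshifts (over possibly different finite alphabets) is a continuous surjection commuting with all $\sigma^g$. A subshift $W$ is sofic if there is an SFT $X$ and a factor map $X\to W$. The entropy of a nonempty subshift is $h(X)=\lim_{n\to\infty}\frac{1}{|F_n|}\log|\mathcal P(F_n,X)|$, where $F_n=[-n,n]^2\cap\mathbb Z^2$ (or any other Følner sequence) and $\mathcal P(F,X)=\{(\sigma^g x)|_F : x\in X, g\in \mathbb Z^2\}$. *)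

theory Defs
  imports "HOL-Analysis.Analysis"
begin

type_synonym 'a config = "int \<times> int \<Rightarrow> 'a"

definition full_shift :: "'a set \<Rightarrow> 'a config topology" where
  "full_shift A = product_topology (\<lambda>_. discrete_topology A) UNIV"

definition shift :: "int \<times> int \<Rightarrow> 'a config \<Rightarrow> 'a config" where
  "shift g x = (\<lambda>h. x (h + g))"

definition subshift :: "'a set \<Rightarrow> 'a config set \<Rightarrow> bool" where
  "subshift A X \<longleftrightarrow>
     finite A \<and> closedin (full_shift A) X \<and> (\<forall>x\<in>X. \<forall>g. shift g x \<in> X)"

definition subsystem :: "'a set \<Rightarrow> 'a config set \<Rightarrow> 'a config set \<Rightarrow> bool" where
  "subsystem A Y X \<longleftrightarrow> subshift A Y \<and> Y \<subseteq> X"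

text \<open>A pattern $p : F \to A$ is a partial map whose domain is the finite set $F$.\<close>

definition pattern :: "'a set \<Rightarrow> (int \<times> int \<rightharpoonup> 'a) \<Rightarrow> bool" where
  "pattern A p \<longleftrightarrow> finite (dom p) \<and> ran p \<subseteq> A"

definition occurs_in :: "(int \<times> int \<rightharpoonup> 'a) \<Rightarrow> 'a config \<Rightarrow> bool" where
  "occurs_in p x \<longleftrightarrow> (\<exists>g. (Some \<circ> shift g x) |` dom p = p)"

definition SFT :: "'a set \<Rightarrow> 'a config set \<Rightarrow> bool" where
  "SFT A X \<longleftrightarrow> finite A \<and>
     (\<exists>P. finite P \<and> (\<forall>p\<in>P. pattern A p) \<and>
          X = {x \<in> topspace (full_shift A). \<forall>p\<in>P. \<not> occurs_in p x})"

definition factor_map ::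
  "'a set \<Rightarrow> 'a config set \<Rightarrow> 'b set \<Rightarrow> 'b config set \<Rightarrow> ('a config \<Rightarrow> 'b config) \<Rightarrow> bool" where
  "factor_map A X B Y f \<longleftrightarrow>
     continuous_map (subtopology (full_shift A) X) (subtopology (full_shift B) Y) f \<and>
     f ` X = Y \<and> (\<forall>x\<in>X. \<forall>g. f (shift g x) = shift g (f x))"

text \<open>The alphabet of the covering SFT may differ from that of \<open>W\<close>. Since HOL cannot quantify
  over types, it ranges over the finite sets of naturals, which represent all finite alphabets
  up to bijection.\<close>

definition sofic :: "'a set \<Rightarrow> 'a config set \<Rightarrow> bool" where
  "sofic A W \<longleftrightarrow> subshift A W \<and>
     (\<exists>(B :: nat set) X f. SFT B X \<and> factor_map B X A W f)"

definition patterns_on :: "(int \<times> int) set \<Rightarrow> 'a config set \<Rightarrow> 'a config set" where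
  "patterns_on F X = {restrict (shift g x) F | x g. x \<in> X}"

definition square :: "nat \<Rightarrow> (int \<times> int) set" where
  "square n = {- int n..int n} \<times> {- int n..int n}"

text \<open>The limit exists for every nonempty subshift, by subadditivity.\<close>

definition entropy :: "'a config set \<Rightarrow> real" where
  "entropy X = lim (\<lambda>n. ln (real (card (patterns_on (square n) X))) / real (card (square n)))"

end

theory Submission
  imports Defs
begin

text \<open>
  The shift constructed below consists of striped configurations: each row is either blank (all
  entries 0) or free (an arbitrary sequence over \<open>{1, 2}\<close>). A hidden layer of tiles, in the style of
  Kari's aperiodic tile sets, decides which rows are blank. Row \<open>j\<close> carries two sequences of bounded
  digits whose averages are reals \<open>X j\<close> in \<open>[2, 6]\<close> and \<open>Y j\<close> in \<open>[0, 4]\<close>. Bounded carries running along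
  the row force affine relations between the averages in rows \<open>j\<close> and \<open>j + 1\<close> (lemma
  \<open>orbit_of_tiling\<close>), and conversely the digits of Beatty sequences realize all solutions of these
  relations (lemma \<open>tiling_of_orbit\<close>).

  The relations describe a rotation with waiting times. In a free row \<open>X\<close> is multiplied by \<open>2\<close> or by
  \<open>2/3\<close>, so that in the coordinate \<open>log 3 (X/2)\<close> it is rotated by \<open>log 3 2\<close> on the circle
  \<open>\<real>/\<int>\<close>, and the next \<open>Y\<close> is \<open>6 - X\<close>. As long as \<open>Y < 1\<close> the rows are blank, \<open>X\<close> stands still and \<open>Y\<close>
  doubles. A visit of \<open>X\<close> at distance \<open>d\<close> from 6 is therefore followed by about \<open>log 2 (1/d)\<close> blank
  rows.

  Entropy. A logarithm of the distance is integrable over the circle, so for a suitable starting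
  point a positive fraction of the rows is free (lemma \<open>exists_dense_orbit\<close>), and every entry of a
  free row contributes a free bit.

  Subsystems of finite type. Since \<open>log 3 2\<close> is irrational, \<open>X\<close> comes as close to 6 as desired within
  a uniformly bounded number of free rows. Hence above and below every free row there are blank
  strips of any prescribed thickness (lemma \<open>zero_strips_around_nonzero_symbol\<close>). Suppose a
  subsystem is given by forbidden patterns of height at most \<open>r\<close> and contains a nonzero
  configuration. Cutting this configuration along two blank strips of thickness \<open>r\<close> and repeating
  the piece in between vertically creates no forbidden pattern, because a window of height \<open>r\<close>
  across a cut sees only blank rows beyond it, before as well as after. The resulting configuration is nonzero and vertically periodic, so it has no
  blank strip thicker than its period, although it belongs to the shift: a contradiction (lemma
  \<open>SFT_subsystem_trivial\<close>). What remains is the zero configuration, which alone is of finite type.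
\<close>

section \<open>Images of nearest-neighbour tilings are sofic\<close>

text \<open>Sites of the lattice are kept as single variables, which suits shifts \<open>h + g\<close> better than
  pairs of coordinates.\<close>
declare split_paired_All [simp del] split_paired_Ex [simp del]

lemma topspace_full_shift: "topspace (full_shift A) = {x. \<forall>h. x h \<in> A}"
  by (auto simp: full_shift_def PiE_def Pi_def)

lemma shift_apply: "shift g x h = x (h + g)"
  by (simp add: shift_def)

lemma continuous_map_coordinate:
  "continuous_map (full_shift A) (discrete_topology A) (\<lambda>x. x h)"
  unfolding full_shift_def by (rule continuous_map_product_projection) simp

lemma openin_cylinder: "openin (full_shift A) {x \<in> topspace (full_shift A). x h = a}"
proof -
  have "openin (full_shift A) {x \<in> topspace (full_shift A). x h \<in> {a} \<inter> A}"
    by (rule openin_continuous_map_preimage[OF continuous_map_coordinate]) simp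
  also have "{x \<in> topspace (full_shift A). x h \<in> {a} \<inter> A} = {x \<in> topspace (full_shift A). x h = a}"
    by (auto simp: topspace_full_shift)
  finally show ?thesis .
qed

lemma occurs_in_iff:
  "occurs_in p x \<longleftrightarrow> (\<exists>g. \<forall>h\<in>dom p. p h = Some (x (h + g)))"
proof -
  have "(Some \<circ> shift g x) |` dom p = p \<longleftrightarrow> (\<forall>h\<in>dom p. p h = Some (x (h + g)))" for g
  proof
    assume eq: "(Some \<circ> shift g x) |` dom p = p"
    show "\<forall>h\<in>dom p. p h = Some (x (h + g))"
    proof
      fix h assume "h \<in> dom p"
      then show "p h = Some (x (h + g))" using fun_cong[OF eq, of h] by (simp add: shift_def)
    qed
  next
    assume "\<forall>h\<in>dom p. p h = Some (x (h + g))"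
    then show "(Some \<circ> shift g x) |` dom p = p"
      by (intro ext) (simp add: restrict_map_def shift_def domIff)
  qed
  then show ?thesis by (simp add: occurs_in_def)
qed

text \<open>The occurrence of a finite pattern at a fixed place is an open condition, and occurring somewhere
  is invariant under translation.\<close>
lemma subshift_SFT:
  assumes "SFT A X"
  shows "subshift A X"
proof -
  obtain P where P: "finite A" "finite P" "\<forall>p\<in>P. pattern A p"
    "X = {x \<in> topspace (full_shift A). \<forall>p\<in>P. \<not> occurs_in p x}"
    using assms by (auto simp: SFT_def)
  define U where "U p g = {x \<in> topspace (full_shift A). \<forall>h\<in>dom p. p h = Some (x (h + g))}" for p g
  have "openin (full_shift A) (U p g)" if "p \<in> P" for p g
  proof -
    have "openin (full_shift A) {x \<in> topspace (full_shift A). p h = Some (x (h + g))}"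
      if "h \<in> dom p" for h
    proof -
      obtain a where "p h = Some a" using \<open>h \<in> dom p\<close> by blast
      then show ?thesis using openin_cylinder[of A "h + g" a]
        by (simp only: option.inject eq_commute[of a])
    qed
    moreover have "finite (dom p)" using \<open>p \<in> P\<close> P(3) by (auto simp: pattern_def)
    ultimately have "openin (full_shift A) (topspace (full_shift A) \<inter>
        (\<Inter>h\<in>dom p. {x \<in> topspace (full_shift A). p h = Some (x (h + g))}))"
      by (cases "dom p = {}") (auto intro!: openin_Int openin_INT2)
    also have "\<dots> = U p g" unfolding U_def by blast
    finally show ?thesis .
  qed
  then have "openin (full_shift A) (\<Union>p\<in>P. \<Union>g. U p g)" by (intro openin_Union) blast
  moreover have "X = topspace (full_shift A) - (\<Union>p\<in>P. \<Union>g. U p g)"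
    unfolding P(4) occurs_in_iff U_def by blast
  ultimately have "closedin (full_shift A) X" by (simp add: closedin_diff)
  moreover have "shift g x \<in> X" if "x \<in> X" for x g
  proof -
    have "occurs_in p x" if "occurs_in p (shift g x)" for p
      using that unfolding occurs_in_iff shift_apply by (metis add.assoc)
    then show ?thesis using that unfolding P(4) by (auto simp add: topspace_full_shift shift_apply)
  qed
  ultimately show ?thesis using P(1) by (auto simp: subshift_def)
qed

text \<open>Recoding letters is a factor map; its image is closed because the full shift over a finite
  alphabet is compact and Hausdorff.\<close>
lemma subshift_factor_image:
  assumes X: "subshift B X" and A: "finite A" and f: "\<And>b. b \<in> B \<Longrightarrow> f b \<in> A"
  shows "subshift A ((\<lambda>x h. f (x h)) ` X)"
    and "factor_map B X A ((\<lambda>x h. f (x h)) ` X) (\<lambda>x h. f (x h))"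
proof -
  let ?F = "\<lambda>x h. f (x h)"
  have B: "finite B" using X by (simp add: subshift_def)
  have cont: "continuous_map (full_shift B) (full_shift A) ?F"
  proof -
    have "continuous_map (full_shift B) (discrete_topology A) (f \<circ> (\<lambda>x. x h))" for h
      by (rule continuous_map_compose[OF continuous_map_coordinate]) (use f in auto)
    then show ?thesis
      unfolding full_shift_def[of A] by (subst continuous_map_componentwise_UNIV) (simp add: o_def)
  qed
  have "compact_space (full_shift B)"
    unfolding full_shift_def by (simp add: compact_space_product_topology compact_space_discrete_topology B)
  then have "compactin (full_shift B) X"
    using X closedin_compact_space by (auto simp: subshift_def)
  then have "compactin (full_shift A) (?F ` X)" using cont image_compactin by blast
  moreover have "Hausdorff_space (full_shift A)"
    unfolding full_shift_def by (simp add: Hausdorff_space_product_topology)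
  ultimately have "closedin (full_shift A) (?F ` X)" using compactin_imp_closedin by blast
  moreover have eq: "?F (shift g x) = shift g (?F x)" for g x by (simp add: shift_def)
  have "shift g w \<in> ?F ` X" if "w \<in> ?F ` X" for g w
  proof -
    obtain x where "x \<in> X" "w = ?F x" using \<open>w \<in> ?F ` X\<close> by blast
    then have "shift g w = ?F (shift g x)" "shift g x \<in> X" using eq X by (simp_all add: subshift_def)
    then show ?thesis by blast
  qed
  ultimately show "subshift A (?F ` X)"
    using A by (simp add: subshift_def)
  show "factor_map B X A (?F ` X) ?F"
    unfolding factor_map_def
  proof (intro conjI ballI allI)
    show "continuous_map (subtopology (full_shift B) X) (subtopology (full_shift A) (?F ` X)) ?F"
      by (intro continuous_map_into_subtopology continuous_map_from_subtopology[OF cont]) auto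
  qed (simp_all only: eq)
qed

text \<open>Rules that relate a cell to its right and its upper neighbour define a shift of finite type once
  the tiles are numbered: the forbidden patterns are the L-shaped triples that violate \<open>R\<close>.\<close>
lemma sofic_tilings:
  fixes S :: "'t set" and R :: "'t \<Rightarrow> 't \<Rightarrow> 't \<Rightarrow> bool"
  assumes S: "finite S" and A: "finite A" and f: "\<And>s. s \<in> S \<Longrightarrow> f s \<in> A"
  shows "sofic A ((\<lambda>x h. f (x h)) `
           {x. \<forall>h. x h \<in> S \<and> R (x h) (x (h + (1, 0))) (x (h + (0, 1)))})"
    (is "sofic A (_ ` ?T)")
proof -
  obtain e :: "'t \<Rightarrow> nat" where e: "inj_on e S"
    using finite_imp_inj_to_nat_seg[OF S] by blast
  define B where "B = e ` S"
  define d where "d = inv_into S e"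
  have d: "d (e s) = s" if "s \<in> S" for s using that e by (simp add: d_def)
  have dB: "d b \<in> S" "e (d b) = b" if "b \<in> B" for b
    using that by (auto simp: B_def d)
  define X where "X = {x :: nat config. \<forall>h. x h \<in> B \<and> R (d (x h)) (d (x (h + (1, 0)))) (d (x (h + (0, 1))))}"
  define pat :: "nat \<times> nat \<times> nat \<Rightarrow> (int \<times> int \<rightharpoonup> nat)"
    where "pat = (\<lambda>(a, b, c). [(0, 0) \<mapsto> a, (1, 0) \<mapsto> b, (0, 1) \<mapsto> c])"
  define P where "P = pat ` {(a, b, c) \<in> B \<times> B \<times> B. \<not> R (d a) (d b) (d c)}"
  have finB: "finite B" using S by (simp add: B_def)
  have dom_pat: "dom (pat (a, b, c)) = {(0, 0), (1, 0), (0, 1)}" for a b c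
    by (auto simp: pat_def)
  have occ: "occurs_in (pat (a, b, c)) x \<longleftrightarrow>
      (\<exists>g. a = x g \<and> b = x (g + (1, 0)) \<and> c = x (g + (0, 1)))" for a b c x
  proof -
    have "pat (a, b, c) (0, 0) = Some a" "pat (a, b, c) (1, 0) = Some b"
      "pat (a, b, c) (0, 1) = Some c" by (simp_all add: pat_def)
    moreover have "(0, 0) + g = g" "(1, 0) + g = g + (1, 0)" "(0, 1) + g = g + (0, 1)"
      for g :: "int \<times> int" by (simp_all add: prod_eq_iff)
    ultimately show ?thesis unfolding occurs_in_iff dom_pat by (simp add: add.commute)
  qed
  have "SFT B X"
    unfolding SFT_def
  proof (intro conjI exI)
    show "finite P"
      unfolding P_def by (intro finite_imageI, rule finite_subset[of _ "B \<times> B \<times> B"]) (auto simp: finB)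
    show "\<forall>p\<in>P. pattern B p"
      by (auto simp: P_def pat_def pattern_def ran_def split: if_splits)
    show "X = {x \<in> topspace (full_shift B). \<forall>p\<in>P. \<not> occurs_in p x}"
    proof (intro equalityI subsetI)
      fix x assume x: "x \<in> X"
      have "\<not> occurs_in p x" if "p \<in> P" for p
      proof -
        obtain a b c where "p = pat (a, b, c)" "\<not> R (d a) (d b) (d c)"
          using \<open>p \<in> P\<close> unfolding P_def by blast
        then show ?thesis using x by (auto simp: occ X_def)
      qed
      then show "x \<in> {x \<in> topspace (full_shift B). \<forall>p\<in>P. \<not> occurs_in p x}"
        using x by (simp add: X_def topspace_full_shift)
    next
      fix x assume x: "x \<in> {x \<in> topspace (full_shift B). \<forall>p\<in>P. \<not> occurs_in p x}"
      have B: "x h \<in> B" for h using x by (simp add: topspace_full_shift)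
      have "R (d (x h)) (d (x (h + (1, 0)))) (d (x (h + (0, 1))))" for h
      proof (rule ccontr)
        assume "\<not> ?thesis"
        then have "pat (x h, x (h + (1, 0)), x (h + (0, 1))) \<in> P" using B by (auto simp: P_def)
        moreover have "occurs_in (pat (x h, x (h + (1, 0)), x (h + (0, 1)))) x"
          unfolding occ by blast
        ultimately show False using x by blast
      qed
      then show "x \<in> X" using B by (simp add: X_def)
    qed
  qed (rule finB)
  have img: "(\<lambda>x h. f (d (x h))) ` X = (\<lambda>x h. f (x h)) ` ?T"
  proof (intro equalityI subsetI)
    fix w assume "w \<in> (\<lambda>x h. f (d (x h))) ` X"
    then obtain x where "x \<in> X" "w = (\<lambda>h. f (d (x h)))" by blast
    moreover from this have "(\<lambda>h. d (x h)) \<in> ?T" using dB by (auto simp: X_def)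
    ultimately show "w \<in> (\<lambda>x h. f (x h)) ` ?T" by (intro image_eqI[of _ _ "\<lambda>h. d (x h)"])
  next
    fix w assume "w \<in> (\<lambda>x h. f (x h)) ` ?T"
    then obtain x where x: "x \<in> ?T" "w = (\<lambda>h. f (x h))" by blast
    then have "(\<lambda>h. e (x h)) \<in> X" using d by (auto simp: X_def B_def)
    moreover have "w = (\<lambda>h. f (d (e (x h))))" using x d by auto
    ultimately show "w \<in> (\<lambda>x h. f (d (x h))) ` X" by (intro image_eqI[of _ _ "\<lambda>h. e (x h)"])
  qed
  have "subshift B X" using subshift_SFT[OF \<open>SFT B X\<close>] .
  note images = subshift_factor_image[where f = "\<lambda>b. f (d b)", OF \<open>subshift B X\<close> A, unfolded img]
  have "f (d b) \<in> A" if "b \<in> B" for b using f dB that by blast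
  then show ?thesis unfolding sofic_def using images \<open>SFT B X\<close> by blast
qed

section \<open>Entropy\<close>

lemma patterns_on_subset:
  assumes "X \<subseteq> topspace (full_shift A)"
  shows "patterns_on F X \<subseteq> F \<rightarrow>\<^sub>E A"
  using assms by (auto simp: patterns_on_def shift_def PiE_def Pi_def topspace_full_shift)

lemma finite_patterns_on:
  assumes "X \<subseteq> topspace (full_shift A)" "finite A" "finite F"
  shows "finite (patterns_on F X)"
  using patterns_on_subset[OF assms(1)] assms(2,3) finite_PiE finite_subset by metis

lemma card_patterns_on_translate:
  "card (patterns_on ((+) v ` F) X) = card (patterns_on F X)"
proof -
  let ?T = "\<lambda>p. \<lambda>h\<in>F. p (v + h)"
  have "inj_on ?T (patterns_on ((+) v ` F) X)"
  proof (intro inj_onI ext)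
    fix p q h assume "p \<in> patterns_on ((+) v ` F) X" "q \<in> patterns_on ((+) v ` F) X" and eq: "?T p = ?T q"
    then have ext: "p \<in> extensional ((+) v ` F)" "q \<in> extensional ((+) v ` F)"
      by (auto simp: patterns_on_def)
    show "p h = q h"
    proof (cases "h \<in> (+) v ` F")
      case True
      then obtain k where k: "k \<in> F" "h = v + k" by blast
      then show ?thesis using fun_cong[OF eq, of k] by simp
    next
      case False then show ?thesis using ext by (metis extensional_arb)
    qed
  qed
  moreover have "?T ` patterns_on ((+) v ` F) X = patterns_on F X"
  proof -
    have *: "?T (restrict (shift g x) ((+) v ` F)) = restrict (shift (v + g) x) F" for g x
      by (auto simp: shift_def restrict_def fun_eq_iff add_ac)
    show ?thesis
    proof (intro equalityI subsetI)
      fix p assume "p \<in> patterns_on F X"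
      then obtain g x where "x \<in> X" "p = restrict (shift (v + (g - v)) x) F"
        by (auto simp: patterns_on_def)
      then have "p = ?T (restrict (shift (g - v) x) ((+) v ` F))" by (simp only: *)
      then show "p \<in> ?T ` patterns_on ((+) v ` F) X"
        using \<open>x \<in> X\<close> unfolding patterns_on_def by blast
    next
      fix p assume "p \<in> ?T ` patterns_on ((+) v ` F) X"
      then obtain g x where "x \<in> X" "p = ?T (restrict (shift g x) ((+) v ` F))"
        unfolding patterns_on_def by blast
      then show "p \<in> patterns_on F X" unfolding patterns_on_def * by blast
    qed
  qed
  ultimately show ?thesis by (metis card_image)
qed

lemma card_patterns_on_Un:
  assumes "finite (patterns_on F X)" "finite (patterns_on G X)"
  shows "card (patterns_on (F \<union> G) X) \<le> card (patterns_on F X) * card (patterns_on G X)"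
proof -
  let ?T = "\<lambda>p. (restrict p F, restrict p G)"
  have "inj_on ?T (patterns_on (F \<union> G) X)"
  proof (intro inj_onI ext)
    fix p q h assume "p \<in> patterns_on (F \<union> G) X" "q \<in> patterns_on (F \<union> G) X" and eq: "?T p = ?T q"
    then have ext: "p \<in> extensional (F \<union> G)" "q \<in> extensional (F \<union> G)"
      by (auto simp: patterns_on_def)
    show "p h = q h"
    proof (cases "h \<in> F \<union> G")
      case True
      then show ?thesis using eq by (metis Un_iff prod.inject restrict_apply')
    next
      case False then show ?thesis using ext by (metis extensional_arb)
    qed
  qed
  moreover have "?T ` patterns_on (F \<union> G) X \<subseteq> patterns_on F X \<times> patterns_on G X"
  proof
    fix r assume "r \<in> ?T ` patterns_on (F \<union> G) X"
    then obtain g x where "x \<in> X" "r = ?T (restrict (shift g x) (F \<union> G))"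
      unfolding patterns_on_def by blast
    moreover from this have "r = (restrict (shift g x) F, restrict (shift g x) G)"
      by (simp add: Int_absorb1)
    ultimately show "r \<in> patterns_on F X \<times> patterns_on G X"
      unfolding patterns_on_def by blast
  qed
  ultimately have "card (patterns_on (F \<union> G) X) \<le> card (patterns_on F X \<times> patterns_on G X)"
    using card_inj_on_le assms by blast
  then show ?thesis by (simp add: card_cartesian_product)
qed

lemma card_patterns_on_UN:
  assumes X: "X \<subseteq> topspace (full_shift A)" "finite A"
    and I: "finite I" "\<And>i. i \<in> I \<Longrightarrow> finite (T i)"
  shows "card (patterns_on (\<Union>i\<in>I. T i) X) \<le> (\<Prod>i\<in>I. card (patterns_on (T i) X))"
  using I
proof (induction I rule: finite_induct)
  case empty
  have "patterns_on {} X \<subseteq> {restrict undefined {}}" by (auto simp: patterns_on_def)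
  then have "card (patterns_on {} X) \<le> card {restrict undefined {} :: 'a config}"
    by (intro card_mono) simp
  then show ?case by simp
next
  case (insert i I)
  have "card (patterns_on (T i \<union> (\<Union>i\<in>I. T i)) X)
      \<le> card (patterns_on (T i) X) * card (patterns_on (\<Union>i\<in>I. T i) X)"
    by (intro card_patterns_on_Un finite_patterns_on[OF X]) (use insert in auto)
  also have "\<dots> \<le> card (patterns_on (T i) X) * (\<Prod>i\<in>I. card (patterns_on (T i) X))"
    using insert by (intro mult_left_mono) auto
  finally show ?case using insert by simp
qed

definition corner_square :: "nat \<Rightarrow> (int \<times> int) set" where
  "corner_square k = {0..<int k} \<times> {0..<int k}"

lemma finite_corner_square [simp]: "finite (corner_square k)" and card_corner_square [simp]: "card (corner_square k) = k * k"
  by (simp_all add: corner_square_def card_cartesian_product)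

lemma corner_square_mult_eq:
  assumes "k > 0"
  shows "corner_square (q * k) = (\<Union>v\<in>corner_square q. (+) (int k * fst v, int k * snd v) ` corner_square k)"
proof (intro equalityI subsetI)
  have kk: "int k > 0" using assms by simp
  fix h assume h: "h \<in> corner_square (q * k)"
  have dm: "0 \<le> z div int k \<and> z div int k < int q \<and> 0 \<le> z mod int k \<and> z mod int k < int k"
    if "0 \<le> z" "z < int (q * k)" for z
  proof -
    have "z div int k < int q"
    proof (rule ccontr)
      assume "\<not> z div int k < int q"
      then have "int q * int k \<le> z div int k * int k" by (intro mult_right_mono) auto
      also have "\<dots> \<le> z" using kk by (metis pos_mod_sign mod_div_decomp le_add_same_cancel1)
      finally show False using that by simp
    qed
    then show ?thesis using that kk by (simp add: pos_imp_zdiv_nonneg_iff)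
  qed
  have "(fst h div int k, snd h div int k) \<in> corner_square q" "(fst h mod int k, snd h mod int k) \<in> corner_square k"
    using h dm[of "fst h"] dm[of "snd h"] by (auto simp: corner_square_def)
  moreover have "h = (int k * (fst h div int k), int k * (snd h div int k)) + (fst h mod int k, snd h mod int k)"
    by (simp add: prod_eq_iff)
  ultimately show "h \<in> (\<Union>v\<in>corner_square q. (+) (int k * fst v, int k * snd v) ` corner_square k)" by force
next
  fix h assume "h \<in> (\<Union>v\<in>corner_square q. (+) (int k * fst v, int k * snd v) ` corner_square k)"
  then obtain v w where h: "v \<in> corner_square q" "w \<in> corner_square k" "h = (int k * fst v + fst w, int k * snd v + snd w)"
    by (auto simp: plus_prod_def)
  have "int k * s + t < int (q * k)" if "0 \<le> s" "s < int q" "0 \<le> t" "t < int k" for s t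
  proof -
    have "int k * (s + 1) \<le> int k * int q" using that by (intro mult_left_mono) auto
    then show ?thesis using that by (simp add: algebra_simps)
  qed
  then show "h \<in> corner_square (q * k)" using h by (auto simp: corner_square_def)
qed

text \<open>The two-dimensional Fekete argument: the square of side \<open>m\<close> is tiled by \<open>(m div k)\<^sup>2\<close> squares of
  side \<open>k\<close>, up to a remainder whose cells are counted trivially.\<close>
lemma card_patterns_on_corner_square_le:
  assumes X: "X \<subseteq> topspace (full_shift A)" "finite A" and k: "k > 0"
  shows "card (patterns_on (corner_square m) X)
     \<le> card (patterns_on (corner_square k) X) ^ ((m div k) * (m div k))
        * card A ^ (m * m - (m div k * k) * (m div k * k))"
proof -
  define q where "q = m div k"
  define C where "C = corner_square m - corner_square (q * k)"
  have sub: "corner_square (q * k) \<subseteq> corner_square m"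
  proof -
    have "q * k \<le> m" by (simp add: q_def)
    then have "int (q * k) \<le> int m" using of_nat_le_iff by blast
    then show ?thesis unfolding corner_square_def by (auto intro: less_le_trans)
  qed
  note fin = finite_patterns_on[OF X]
  have "card (patterns_on (corner_square m) X) = card (patterns_on (corner_square (q * k) \<union> C) X)"
    using sub by (simp add: C_def Un_absorb1)
  also have "\<dots> \<le> card (patterns_on (corner_square (q * k)) X) * card (patterns_on C X)"
    by (intro card_patterns_on_Un fin) (auto simp: C_def)
  also have "card (patterns_on C X) \<le> card A ^ card C"
  proof -
    have "card (patterns_on C X) \<le> card (C \<rightarrow>\<^sub>E A)"
      by (intro card_mono patterns_on_subset finite_PiE X) (auto simp: C_def X)
    then show ?thesis by (simp add: card_PiE C_def)
  qed
  also have "card C = m * m - (q * k) * (q * k)"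
    unfolding C_def by (subst card_Diff_subset) (use sub in auto)
  also have "card (patterns_on (corner_square (q * k)) X)
      \<le> (\<Prod>v\<in>corner_square q. card (patterns_on ((+) (int k * fst v, int k * snd v) ` corner_square k) X))"
    unfolding corner_square_mult_eq[OF k] by (rule card_patterns_on_UN[OF X]) auto
  also have "\<dots> = card (patterns_on (corner_square k) X) ^ (q * q)"
    by (simp add: card_patterns_on_translate)
  finally show ?thesis by (simp add: q_def)
qed

lemma card_patterns_on_pos:
  assumes X: "X \<subseteq> topspace (full_shift A)" "finite A" "X \<noteq> {}" "finite F"
  shows "card (patterns_on F X) > 0"
proof -
  have "patterns_on F X \<noteq> {}" using X(3) by (auto simp: patterns_on_def)
  then show ?thesis using finite_patterns_on[OF X(1,2,4)] by (simp add: card_gt_0_iff)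
qed

text \<open>The remainder in the previous bound has at most \<open>2 * k * m\<close> cells, which is negligible against
  \<open>m * m\<close>. So the ratios converge to their infimum.\<close>
lemma convergent_corner_square_entropy:
  assumes X: "X \<subseteq> topspace (full_shift A)" "finite A" "X \<noteq> {}"
  shows "convergent (\<lambda>m. ln (real (card (patterns_on (corner_square m) X))) / real (m * m))"
proof -
  define a where "a m = ln (real (card (patterns_on (corner_square m) X)))" for m
  define b where "b m = a m / real (m * m)" for m
  define c where "c = ln (real (card A))"
  have A: "card A > 0" using X by (auto simp: card_gt_0_iff topspace_full_shift)
  have pos: "card (patterns_on (corner_square m) X) > 0" for m
    by (rule card_patterns_on_pos[OF X]) simp
  have a0: "a m \<ge> 0" for m using pos[of m] by (simp add: a_def)
  have c0: "c \<ge> 0" using A by (simp add: c_def)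
  have b0: "b m \<ge> 0" for m using a0 by (simp add: b_def)
  have step: "b m \<le> b k + c * (2 * real k / real m)" if k: "k > 0" and m: "m > 0" for k m
  proof -
    define q where "q = m div k"
    have qk: "q * k \<le> m" "m < q * k + k"
      using k by (auto simp: q_def) (metis add.commute dividend_less_times_div mult.commute)
    have "a m \<le> ln (real (card (patterns_on (corner_square k) X) ^ (q * q) * card A ^ (m * m - (q * k) * (q * k))))"
      unfolding a_def q_def
      by (subst ln_le_cancel_iff) (use card_patterns_on_corner_square_le[OF X(1,2) k, of m] pos A in \<open>auto simp del: of_nat_mult of_nat_power\<close>)
    also have "\<dots> = real (q * q) * a k + real (m * m - (q * k) * (q * k)) * c"
      using pos[of k] A by (simp add: a_def c_def ln_mult ln_realpow)
    also have "\<dots> = real (q * k * (q * k)) * b k + real (m * m - (q * k) * (q * k)) * c"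
      using k by (simp add: b_def)
    also have "\<dots> \<le> real (m * m) * b k + real (2 * k * m) * c"
    proof (intro add_mono mult_right_mono b0 c0)
      show "real (q * k * (q * k)) \<le> real (m * m)" using qk by (intro of_nat_mono mult_mono) auto
      have "m * m \<le> (q * k) * (q * k) + 2 * k * m"
      proof -
        obtain d where d: "m = q * k + d" using qk(1) le_Suc_ex by blast
        then have "d \<le> k" using qk by simp
        have "m * m = (q * k) * (q * k) + d * (q * k + m)" by (simp add: d algebra_simps)
        also have "\<dots> \<le> (q * k) * (q * k) + k * (m + m)"
          using \<open>d \<le> k\<close> qk by (intro add_mono mult_mono) auto
        finally show ?thesis by (simp add: algebra_simps)
      qed
      then show "real (m * m - q * k * (q * k)) \<le> real (2 * k * m)" by (intro of_nat_mono) simp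
    qed
    finally show ?thesis using m by (simp add: b_def field_simps)
  qed
  define L where "L = Inf (b ` {0<..})"
  have bdd: "bdd_below (b ` {0<..})" using b0 by (auto intro!: bdd_belowI)
  have "b \<longlonglongrightarrow> L"
  proof (rule LIMSEQ_I)
    fix e :: real assume e: "e > 0"
    have "L < L + e / 2" using e by simp
    then obtain k where k: "k > 0" "b k < L + e / 2"
      unfolding L_def using cInf_lessD[of "b ` {0<..}" "Inf (b ` {0<..}) + e / 2"] by auto
    have "(\<lambda>m. c * (2 * real k / real m)) \<longlonglongrightarrow> 0" by (intro tendsto_mult_right_zero lim_const_over_n)
    then obtain N where N: "\<And>m. m \<ge> N \<Longrightarrow> c * (2 * real k / real m) < e / 2"
      using e order_tendstoD(2)[of "\<lambda>m. c * (2 * real k / real m)" 0 sequentially "e / 2"]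
      unfolding eventually_sequentially by (metis half_gt_zero)
    have "norm (b m - L) < e" if "m \<ge> N + 1" for m
    proof -
      have "b m < L + e" using step[OF k(1), of m] k(2) N[of m] that by auto
      moreover have "L \<le> b m" unfolding L_def using that by (intro cInf_lower bdd) auto
      ultimately show ?thesis by simp
    qed
    then show "\<exists>no. \<forall>n\<ge>no. norm (b n - L) < e" by blast
  qed
  then show ?thesis unfolding convergent_def b_def a_def by blast
qed

lemma square_eq_translate_corner_square: "square n = (+) (- int n, - int n) ` corner_square (2 * n + 1)"
proof (intro equalityI subsetI)
  fix h assume "h \<in> square n"
  then have "h = (- int n, - int n) + (h + (int n, int n))" "h + (int n, int n) \<in> corner_square (2 * n + 1)"
    by (auto simp: square_def corner_square_def prod_eq_iff)
  then show "h \<in> (+) (- int n, - int n) ` corner_square (2 * n + 1)" by blast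
qed (auto simp: square_def corner_square_def)

text \<open>Centred squares are translates of corner squares of odd side, so the defining limit of the
  entropy is taken along a subsequence of a convergent sequence.\<close>
lemma entropy_ge:
  assumes X: "X \<subseteq> topspace (full_shift A)" "finite A" "X \<noteq> {}"
    and le: "\<And>n. n \<ge> n0 \<Longrightarrow> d * real (n * n) \<le> ln (real (card (patterns_on (corner_square n) X)))"
  shows "entropy X \<ge> d"
proof -
  let ?b = "\<lambda>m. ln (real (card (patterns_on (corner_square m) X))) / real (m * m)"
  obtain L where L: "?b \<longlonglongrightarrow> L" using convergent_corner_square_entropy[OF X] by (auto simp: convergent_def)
  have "(\<lambda>n. ?b (2 * n + 1)) \<longlonglongrightarrow> L"
    using LIMSEQ_subseq_LIMSEQ[OF L, of "\<lambda>n. 2 * n + 1"]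
    unfolding o_def by (simp only: strict_mono_def) auto
  moreover have "?b (2 * n + 1) = ln (real (card (patterns_on (square n) X))) / real (card (square n))" for n
    unfolding square_eq_translate_corner_square card_patterns_on_translate
    by (subst card_image) (auto simp: algebra_simps simp flip: of_nat_mult)
  ultimately have "entropy X = L" unfolding entropy_def by (simp add: limI)
  moreover have "d \<le> L"
  proof (rule tendsto_lowerbound[OF L])
    show "\<forall>\<^sub>F n in sequentially. d \<le> ?b n"
      using eventually_ge_at_top[of "max 1 n0"]
    proof eventually_elim
      case (elim n)
      then show ?case using le[of n] by (simp add: field_simps)
    qed
  qed simp
  ultimately show ?thesis by simp
qed

section \<open>The tiles\<close>

text \<open>The phase of a row tells how its reals pass to the row above: \<open>Wait\<close> rows are blank, \<open>Double\<close> and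
  \<open>Shrink\<close> rows are free and multiply \<open>X\<close> by \<open>2\<close> and by \<open>2/3\<close>.\<close>
datatype phase = Wait | Double | Shrink

datatype tile = Tile (phase: phase) (colour: nat)
  (x_digit: int) (y_digit: int) (x_carry: int) (y_carry: int)

text \<open>Restricting the digits of a row to an interval with integer endpoints restricts their average to
  the same interval. This is how the phase is tied to the values of \<open>X\<close> and \<open>Y\<close>.\<close>
definition tiles :: "tile set" where
  "tiles = {t. colour t \<in> {1, 2} \<and> x_digit t \<in> {2..6} \<and> y_digit t \<in> {0..4} \<and>
     x_carry t \<in> {-3..3} \<and> y_carry t \<in> {-3..3} \<and>
     (case phase t of
        Wait \<Rightarrow> y_digit t \<le> 1
      | Double \<Rightarrow> x_digit t \<le> 3 \<and> 1 \<le> y_digit t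
      | Shrink \<Rightarrow> 3 \<le> x_digit t \<and> 1 \<le> y_digit t)}"

text \<open>The differences of consecutive carries are the local defects of the relations
  \<open>X' = X\<close>, \<open>X' = 2 * X\<close>, \<open>3 * X' = 2 * X\<close> and \<open>Y' = 2 * Y\<close>, \<open>Y' + X' = 6\<close>. As carries are bounded, the
  defects average to zero along a row.\<close>
definition compatible :: "tile \<Rightarrow> tile \<Rightarrow> tile \<Rightarrow> bool" where
  "compatible t right up \<longleftrightarrow> phase right = phase t \<and>
     x_carry right - x_carry t =
       (case phase t of
          Wait \<Rightarrow> x_digit up - x_digit t
        | Double \<Rightarrow> x_digit up - 2 * x_digit t
        | Shrink \<Rightarrow> 3 * x_digit up - 2 * x_digit t) \<and>
     y_carry right - y_carry t =
       (case phase t of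
          Wait \<Rightarrow> y_digit up - 2 * y_digit t
        | _ \<Rightarrow> y_digit up + x_digit up - 6)"

definition tilings :: "tile config set" where
  "tilings = {x. \<forall>h. x h \<in> tiles \<and> compatible (x h) (x (h + (1, 0))) (x (h + (0, 1)))}"

definition symbol :: "tile \<Rightarrow> nat" where
  "symbol t = (if phase t = Wait then 0 else colour t)"

definition striped_shift :: "nat config set" where
  "striped_shift = (\<lambda>x h. symbol (x h)) ` tilings"

lemma finite_tiles: "finite tiles"
proof -
  have "tiles \<subseteq> (\<lambda>(p, c, a, b, d, e). Tile p c a b d e) `
      ({Wait, Double, Shrink} \<times> {1, 2} \<times> {2..6} \<times> {0..4} \<times> {-3..3} \<times> {-3..3})"
  proof
    fix t assume t: "t \<in> tiles"
    have "phase t \<in> {Wait, Double, Shrink}" by (cases "phase t") auto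
    with t have "(phase t, colour t, x_digit t, y_digit t, x_carry t, y_carry t)
        \<in> {Wait, Double, Shrink} \<times> {1, 2} \<times> {2..6} \<times> {0..4} \<times> {-3..3} \<times> {-3..3}"
      by (simp add: tiles_def)
    then show "t \<in> (\<lambda>(p, c, a, b, d, e). Tile p c a b d e) `
      ({Wait, Double, Shrink} \<times> {1, 2} \<times> {2..6} \<times> {0..4} \<times> {-3..3} \<times> {-3..3})"
      by (rule rev_image_eqI) simp
  qed
  then show ?thesis by (rule finite_subset) simp
qed

lemma sofic_striped_shift: "sofic {0, 1, 2} striped_shift"
  unfolding striped_shift_def tilings_def
  by (rule sofic_tilings[OF finite_tiles]) (auto simp: symbol_def tiles_def)

section \<open>Rows of a tiling represent real numbers\<close>

text \<open>At the boundary values \<open>Y j = 1\<close> and \<open>X j = 3\<close> two phases are possible. All conditions are closed,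
  as they must be to hold for limits of averages.\<close>
definition orbit :: "(int \<Rightarrow> phase) \<Rightarrow> (int \<Rightarrow> real) \<Rightarrow> (int \<Rightarrow> real) \<Rightarrow> bool" where
  "orbit \<phi> X Y \<longleftrightarrow> (\<forall>j. 2 \<le> X j \<and> X j \<le> 6 \<and> 0 \<le> Y j \<and> Y j \<le> 4 \<and>
     (case \<phi> j of
        Wait \<Rightarrow> Y j \<le> 1 \<and> X (j + 1) = X j \<and> Y (j + 1) = 2 * Y j
      | Double \<Rightarrow> X j \<le> 3 \<and> 1 \<le> Y j \<and> X (j + 1) = 2 * X j \<and> Y (j + 1) = 6 - X (j + 1)
      | Shrink \<Rightarrow> 3 \<le> X j \<and> 1 \<le> Y j \<and> 3 * X (j + 1) = 2 * X j \<and> Y (j + 1) = 6 - X (j + 1)))"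

lemma
  assumes "orbit \<phi> X Y"
  shows orbit_bounds: "2 \<le> X j" "X j \<le> 6"
    and orbit_Wait: "\<phi> j = Wait \<Longrightarrow> X (j + 1) = X j \<and> Y (j + 1) = 2 * Y j"
    and orbit_Double: "\<phi> j = Double \<Longrightarrow> X (j + 1) = 2 * X j"
    and orbit_Shrink: "\<phi> j = Shrink \<Longrightarrow> X (j + 1) = 2 * X j / 3"
    and orbit_active: "\<phi> j \<noteq> Wait \<Longrightarrow> 1 \<le> Y j \<and> Y (j + 1) = 6 - X (j + 1)"
  using spec[OF assms[unfolded orbit_def], of j] by (auto split: phase.splits)

text \<open>The averages in all rows are needed along one common subsequence.\<close>
lemma pointwise_convergent_subsequence:
  fixes v :: "nat \<Rightarrow> 'i::countable \<Rightarrow> real"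
  assumes "\<And>n i. v n i \<in> {a..b}"
  obtains r l where "strict_mono r" "\<And>i. (\<lambda>n. v (r n) i) \<longlonglongrightarrow> l i"
proof -
  have "compactin (product_topology (\<lambda>_::'i. euclidean) UNIV) (PiE UNIV (\<lambda>_. {a..b}))"
    by (subst compactin_PiE) auto
  then have "compact (PiE UNIV (\<lambda>_::'i. {a..b}))"
    by (simp add: euclidean_product_topology)
  then have sc: "seq_compact (PiE UNIV (\<lambda>_::'i. {a..b}))" by (rule compact_imp_seq_compact)
  have v: "\<forall>n. v n \<in> PiE UNIV (\<lambda>_. {a..b})" using assms by auto
  obtain l r where r: "strict_mono r" and l: "(v \<circ> r) \<longlonglongrightarrow> l"
    using sc[unfolded seq_compact_def, THEN spec, THEN mp, OF v] by blast
  have "(\<lambda>n. v (r n) i) \<longlonglongrightarrow> l i" for i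
  proof -
    have "isCont (\<lambda>f :: 'i \<Rightarrow> real. f i) l"
      using continuous_on_product_coordinates[of i, where 'b = real]
      by (subst (asm) continuous_on_eq_continuous_at) auto
    then have "(\<lambda>n. (v \<circ> r) n i) \<longlonglongrightarrow> l i" using l by (rule isCont_tendsto_compose)
    then show ?thesis by (simp only: o_def)
  qed
  with r show ?thesis by (rule that)
qed

lemma phase_constant_on_rows:
  assumes x: "x \<in> tilings"
  shows "phase (x (i, j)) = phase (x (0, j))"
proof (induction i rule: int_induct[where k = 0])
  case (step1 i)
  have "phase (x ((i, j) + (1, 0))) = phase (x (i, j))"
    using x unfolding tilings_def compatible_def by blast
  then show ?case using step1 by simp
next
  case (step2 i)
  have "phase (x ((i - 1, j) + (1, 0))) = phase (x (i - 1, j))"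
    using x unfolding tilings_def compatible_def by blast
  then show ?case using step2 by simp
qed simp

lemma tendsto_zero_of_bounded:
  fixes L :: "nat \<Rightarrow> real"
  assumes "\<And>n. \<bar>L n\<bar> \<le> C" "strict_mono r"
  shows "(\<lambda>n. L (r n) / real (r n)) \<longlonglongrightarrow> 0"
proof (rule Lim_null_comparison)
  show "\<forall>\<^sub>F n in sequentially. norm (L (r n) / real (r n)) \<le> C / real n"
    using eventually_gt_at_top[of 0]
  proof eventually_elim
    case (elim n)
    have "n \<le> r n" using assms(2) seq_suble by blast
    then have "\<bar>L (r n)\<bar> / real (r n) \<le> C / real n"
      using elim assms(1)[of "r n"] by (intro frac_le) auto
    then show ?case by simp
  qed
  show "(\<lambda>n. C / real n) \<longlonglongrightarrow> 0" using lim_const_over_n by blast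
qed

text \<open>The rows of a tiling need not have well-defined averages, but along a subsequence of
  initial segments all averages converge. The limits satisfy the relations exactly since the carries,
  being bounded, disappear after division by the length of the segment.\<close>
lemma orbit_of_tiling:
  assumes x: "x \<in> tilings"
  obtains X Y where "orbit (\<lambda>j. phase (x (0, j))) X Y"
proof -
  define d where "d k i = (if fst k then x_digit (x (i, snd k)) else y_digit (x (i, snd k)))"
    for k :: "bool \<times> int" and i
  define S where "S k n = (\<Sum>i<n. real_of_int (d k (int i)))" for k n
  have tile: "x h \<in> tiles" for h using x by (simp add: tilings_def)
  have comp: "compatible (x (i, j)) (x (i + 1, j)) (x (i, j + 1))" for i j
  proof -
    have "compatible (x (i, j)) (x ((i, j) + (1, 0))) (x ((i, j) + (0, 1)))"
      using x unfolding tilings_def by blast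
    then show ?thesis by simp
  qed
  have dbound: "0 \<le> d k i \<and> d k i \<le> 6" for k i
    using tile[of "(i, snd k)"] by (auto simp: d_def tiles_def)
  have Sbound: "S k n / real n \<in> {0..6}" for k n
  proof -
    have "0 \<le> S k n" unfolding S_def using dbound by (intro sum_nonneg) auto
    moreover have "S k n \<le> (\<Sum>i<n. 6)" unfolding S_def by (intro sum_mono) (use dbound in auto)
    ultimately show ?thesis by (cases "n = 0") (auto simp: field_simps)
  qed
  then obtain r l where r: "strict_mono r" and l: "\<And>k. (\<lambda>n. S k (r n) / real (r n)) \<longlonglongrightarrow> l k"
    using pointwise_convergent_subsequence[of "\<lambda>n k. S k n / real n" 0 6] by metis
  have rpos: "\<forall>\<^sub>F n in sequentially. r n > 0"
    using eventually_gt_at_top[of 0] by eventually_elim (meson r seq_suble less_le_trans)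
  \<comment> \<open>an affine relation between digits that telescopes passes to the limit\<close>
  have rel: "a1 * l k1 + a2 * l k2 + a3 * l k3 = a0"
    if "\<And>n. \<bar>\<Sum>i<n. a1 * real_of_int (d k1 (int i)) + a2 * real_of_int (d k2 (int i)) + a3 * real_of_int (d k3 (int i)) - a0\<bar> \<le> C"
    for a0 a1 a2 a3 C k1 k2 k3
  proof -
    define L where "L n = a1 * S k1 n + a2 * S k2 n + a3 * S k3 n - real n * a0" for n
    have "\<bar>L n\<bar> \<le> C" for n
      using that[of n] by (simp add: L_def S_def sum.distrib sum_subtractf sum_distrib_left)
    then have "(\<lambda>n. L (r n) / real (r n)) \<longlonglongrightarrow> 0" using r by (rule tendsto_zero_of_bounded)
    moreover have "(\<lambda>n. L (r n) / real (r n)) \<longlonglongrightarrow> a1 * l k1 + a2 * l k2 + a3 * l k3 - a0"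
    proof (rule Lim_transform_eventually)
      show "(\<lambda>n. a1 * (S k1 (r n) / real (r n)) + a2 * (S k2 (r n) / real (r n))
          + a3 * (S k3 (r n) / real (r n)) - a0) \<longlonglongrightarrow> a1 * l k1 + a2 * l k2 + a3 * l k3 - a0"
        by (intro tendsto_intros l)
      show "\<forall>\<^sub>F n in sequentially. a1 * (S k1 (r n) / real (r n)) + a2 * (S k2 (r n) / real (r n))
          + a3 * (S k3 (r n) / real (r n)) - a0 = L (r n) / real (r n)"
        using rpos by eventually_elim (simp add: L_def field_simps)
    qed
    ultimately show ?thesis using LIMSEQ_unique by fastforce
  qed
  have bounds: "a \<le> l k" if "\<And>i. real_of_int (d k i) \<ge> a" for a k
  proof (rule tendsto_lowerbound[OF l])
    have "real n * a \<le> S k n" for n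
      unfolding S_def using sum_mono[of "{..<n}" "\<lambda>_. a" "\<lambda>i. real_of_int (d k (int i))"] that by simp
    then show "\<forall>\<^sub>F n in sequentially. a \<le> S k (r n) / real (r n)"
      using rpos by (elim eventually_mono) (simp add: pos_le_divide_eq pos_divide_le_eq mult.commute)
  qed simp
  have bounds': "l k \<le> a" if "\<And>i. real_of_int (d k i) \<le> a" for a k
  proof (rule tendsto_upperbound[OF l])
    have "S k n \<le> real n * a" for n
      unfolding S_def using sum_mono[of "{..<n}" "\<lambda>i. real_of_int (d k (int i))" "\<lambda>_. a"] that by simp
    then show "\<forall>\<^sub>F n in sequentially. S k (r n) / real (r n) \<le> a"
      using rpos by (elim eventually_mono) (simp add: pos_le_divide_eq pos_divide_le_eq mult.commute)
  qed simp
  have tele: "\<bar>\<Sum>i<n. f i\<bar> \<le> 6"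
    if "\<And>i. f i = real_of_int (c (int i + 1) - c (int i))" "\<And>i. c i \<in> {-3..3}" for f c and n :: nat
  proof -
    have "(\<Sum>i<n. f i) = real_of_int (c (int n) - c 0)"
      by (induction n) (simp_all add: that(1) add.commute)
    then show ?thesis using that(2)[of "int n"] that(2)[of 0] by (auto simp: abs_le_iff)
  qed
  have xc: "x_carry (x h) \<in> {-3..3}" "y_carry (x h) \<in> {-3..3}" for h
    using tile[of h] by (auto simp: tiles_def)
  let ?X = "\<lambda>j. l (True, j)" and ?Y = "\<lambda>j. l (False, j)"
  have "2 \<le> ?X j \<and> ?X j \<le> 6 \<and> 0 \<le> ?Y j \<and> ?Y j \<le> 4 \<and>
     (case phase (x (0, j)) of
        Wait \<Rightarrow> ?Y j \<le> 1 \<and> ?X (j + 1) = ?X j \<and> ?Y (j + 1) = 2 * ?Y j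
      | Double \<Rightarrow> ?X j \<le> 3 \<and> 1 \<le> ?Y j \<and> ?X (j + 1) = 2 * ?X j \<and> ?Y (j + 1) = 6 - ?X (j + 1)
      | Shrink \<Rightarrow> 3 \<le> ?X j \<and> 1 \<le> ?Y j \<and> 3 * ?X (j + 1) = 2 * ?X j \<and> ?Y (j + 1) = 6 - ?X (j + 1))"
    for j
  proof -
    have ph: "phase (x (i, j)) = phase (x (0, j))" for i using phase_constant_on_rows[OF x] .
    have t: "2 \<le> x_digit (x (i, j)) \<and> x_digit (x (i, j)) \<le> 6 \<and> 0 \<le> y_digit (x (i, j)) \<and> y_digit (x (i, j)) \<le> 4" for i
      using tile[of "(i, j)"] by (auto simp: tiles_def)
    have range: "2 \<le> ?X j" "?X j \<le> 6" "0 \<le> ?Y j" "?Y j \<le> 4"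
      by (rule bounds bounds'; use t in \<open>simp add: d_def\<close>)+
    show ?thesis
    proof (cases "phase (x (0, j))")
      case p: Wait
      have q: "phase (x (i, j)) = Wait" for i using ph[of i] p by simp
      have digits: "y_digit (x (i, j)) \<le> 1" for i
        using tile[of "(i, j)"] q[of i] by (simp_all add: tiles_def)
      have "?Y j \<le> 1"
        by (rule bounds bounds'; use digits in \<open>simp add: d_def\<close>)+
      moreover have "1 * ?X (j + 1) + (-1) * ?X j + 0 * ?X j = 0"
      proof (rule rel[where C = 6], rule tele[where c = "\<lambda>i. x_carry (x (i, j))"])
        fix i show "1 * real_of_int (d (True, j + 1) (int i)) + - 1 * real_of_int (d (True, j) (int i)) + 0 * real_of_int (d (True, j) (int i)) - 0 = real_of_int (x_carry (x (int i + 1, j)) - x_carry (x (int i, j)))"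
          using comp[of "int i" j] q[of "int i"] by (simp add: d_def compatible_def)
      qed (rule xc)
      moreover have "1 * ?Y (j + 1) + (-2) * ?Y j + 0 * ?X j = 0"
      proof (rule rel[where C = 6], rule tele[where c = "\<lambda>i. y_carry (x (i, j))"])
        fix i show "1 * real_of_int (d (False, j + 1) (int i)) + - 2 * real_of_int (d (False, j) (int i)) + 0 * real_of_int (d (True, j) (int i)) - 0 = real_of_int (y_carry (x (int i + 1, j)) - y_carry (x (int i, j)))"
          using comp[of "int i" j] q[of "int i"] by (simp add: d_def compatible_def)
      qed (rule xc)
      ultimately show ?thesis using range p by simp
    next
      case p: Double
      have q: "phase (x (i, j)) = Double" for i using ph[of i] p by simp
      have digits: "x_digit (x (i, j)) \<le> 3" "1 \<le> y_digit (x (i, j))" for i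
        using tile[of "(i, j)"] q[of i] by (simp_all add: tiles_def)
      have "?X j \<le> 3" "1 \<le> ?Y j"
        by (rule bounds bounds'; use digits in \<open>simp add: d_def\<close>)+
      moreover have "1 * ?X (j + 1) + (-2) * ?X j + 0 * ?X j = 0"
      proof (rule rel[where C = 6], rule tele[where c = "\<lambda>i. x_carry (x (i, j))"])
        fix i show "1 * real_of_int (d (True, j + 1) (int i)) + - 2 * real_of_int (d (True, j) (int i)) + 0 * real_of_int (d (True, j) (int i)) - 0 = real_of_int (x_carry (x (int i + 1, j)) - x_carry (x (int i, j)))"
          using comp[of "int i" j] q[of "int i"] by (simp add: d_def compatible_def)
      qed (rule xc)
      moreover have "1 * ?Y (j + 1) + 1 * ?X (j + 1) + 0 * ?X j = 6"
      proof (rule rel[where C = 6], rule tele[where c = "\<lambda>i. y_carry (x (i, j))"])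
        fix i show "1 * real_of_int (d (False, j + 1) (int i)) + 1 * real_of_int (d (True, j + 1) (int i)) + 0 * real_of_int (d (True, j) (int i)) - 6 = real_of_int (y_carry (x (int i + 1, j)) - y_carry (x (int i, j)))"
          using comp[of "int i" j] q[of "int i"] by (simp add: d_def compatible_def)
      qed (rule xc)
      ultimately show ?thesis using range p by simp
    next
      case p: Shrink
      have q: "phase (x (i, j)) = Shrink" for i using ph[of i] p by simp
      have digits: "3 \<le> x_digit (x (i, j))" "1 \<le> y_digit (x (i, j))" for i
        using tile[of "(i, j)"] q[of i] by (simp_all add: tiles_def)
      have "3 \<le> ?X j" "1 \<le> ?Y j"
        by (rule bounds bounds'; use digits in \<open>simp add: d_def\<close>)+
      moreover have "3 * ?X (j + 1) + (-2) * ?X j + 0 * ?X j = 0"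
      proof (rule rel[where C = 6], rule tele[where c = "\<lambda>i. x_carry (x (i, j))"])
        fix i show "3 * real_of_int (d (True, j + 1) (int i)) + - 2 * real_of_int (d (True, j) (int i)) + 0 * real_of_int (d (True, j) (int i)) - 0 = real_of_int (x_carry (x (int i + 1, j)) - x_carry (x (int i, j)))"
          using comp[of "int i" j] q[of "int i"] by (simp add: d_def compatible_def)
      qed (rule xc)
      moreover have "1 * ?Y (j + 1) + 1 * ?X (j + 1) + 0 * ?X j = 6"
      proof (rule rel[where C = 6], rule tele[where c = "\<lambda>i. y_carry (x (i, j))"])
        fix i show "1 * real_of_int (d (False, j + 1) (int i)) + 1 * real_of_int (d (True, j + 1) (int i)) + 0 * real_of_int (d (True, j) (int i)) - 6 = real_of_int (y_carry (x (int i + 1, j)) - y_carry (x (int i, j)))"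
          using comp[of "int i" j] q[of "int i"] by (simp add: d_def compatible_def)
      qed (rule xc)
      ultimately show ?thesis using range p by simp
    qed
  qed
  then show ?thesis using that[of ?X ?Y] by (simp add: orbit_def)
qed

section \<open>Long waiting periods\<close>

lemma two_pow_neq_three_pow:
  assumes "q > 0"
  shows "(2::real) ^ q \<noteq> 3 ^ p"
proof
  assume "(2::real) ^ q = 3 ^ p"
  then have "real (2 ^ q) = real (3 ^ p)" by simp
  then have "(2::nat) ^ q = 3 ^ p" using of_nat_eq_iff by blast
  moreover have "even ((2::nat) ^ q)" "odd ((3::nat) ^ p)" using assms by auto
  ultimately show False by simp
qed

lemma log_3_2_irrational: "log 3 2 \<notin> \<rat>"
proof
  assume "log 3 2 \<in> \<rat>"
  then obtain a b where ab: "b > 0" "log 3 2 = of_int a / of_int b" by (elim Rats_cases')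
  have "0 < log 3 (2::real)" by simp
  then have a: "a > 0" using ab by (simp add: zero_less_divide_iff)
  have "log 3 (2 ^ nat b) = log 3 (3 ^ nat a)"
    using ab a by (simp add: log_nat_power)
  then have "(2::real) ^ nat b = 3 ^ nat a" using log_inj[of 3] by (auto simp: inj_on_def)
  then show False using two_pow_neq_three_pow[of "nat b"] ab by auto
qed

text \<open>The irrational rotation by \<open>log 3 2\<close> has small positive fractional parts; raising 3 to these
  powers gives the quotients.\<close>
lemma two_pow_over_three_pow_close_to_1:
  assumes "\<eta> > 0"
  obtains q p where "q > 0" "1 < (2::real) ^ q / 3 ^ p" "(2::real) ^ q / 3 ^ p < 1 + \<eta>"
proof -
  define \<alpha> where "\<alpha> = min 1 (log 3 (1 + \<eta>) / 2)"
  have \<alpha>: "0 < \<alpha>" "\<alpha> \<le> 1" using assms by (auto simp: \<alpha>_def)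
  obtain k :: nat where k: "k > 0" "\<bar>frac (real k * log 3 2) - \<alpha>\<bar> < \<alpha>"
    using Kronecker_approx_1_explicit[OF log_3_2_irrational, of \<alpha> \<alpha>] \<alpha> by auto
  define p where "p = nat \<lfloor>real k * log 3 2\<rfloor>"
  have eq: "2 ^ k / 3 ^ p = (3::real) powr frac (real k * log 3 2)"
  proof -
    have "real p = real_of_int \<lfloor>real k * log 3 2\<rfloor>" by (simp add: p_def)
    then have "frac (real k * log 3 2) = real k * log 3 2 - real p" by (simp add: frac_def)
    also have "3 powr \<dots> = (3 powr log 3 2) powr real k / 3 powr real p"
      by (simp only: powr_diff powr_powr mult.commute)
    finally show ?thesis by (simp add: powr_realpow)
  qed
  have "0 < frac (real k * log 3 2)" "frac (real k * log 3 2) < 2 * \<alpha>"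
    using k(2) by linarith+
  moreover have "2 * \<alpha> \<le> log 3 (1 + \<eta>)" by (simp add: \<alpha>_def)
  ultimately have "3 powr frac (real k * log 3 2) < 3 powr log 3 (1 + \<eta>)" "1 < 3 powr frac (real k * log 3 2)"
    by (auto intro!: powr_less_mono)
  then show ?thesis using that[of k p] k(1) assms by (simp add: eq)
qed

text \<open>Minimality of the rotation, uniformly in the starting point. Multiplication by a quotient
  \<open>s = 2 ^ q / 3 ^ p\<close> slightly above 1 moves \<open>x\<close> in small steps, so some \<open>x * s ^ m\<close> lies just below
  18, and the only power of 3 that brings this value back to \<open>[2, 6]\<close> puts it just below 6. Aiming at
  18 and not at 6 guarantees \<open>m > 0\<close>, even for \<open>x = 6\<close>.\<close>
lemma multiples_come_close_to_6:
  assumes \<delta>: "\<delta> > 0"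
  obtains K :: nat where "\<And>x::real. 2 \<le> x \<Longrightarrow> x \<le> 6 \<Longrightarrow> \<exists>n\<in>{1..K}. \<forall>t.
    2 \<le> x * 2 ^ n / 3 ^ t \<longrightarrow> x * 2 ^ n / 3 ^ t \<le> 6 \<longrightarrow>
    6 - \<delta> < x * 2 ^ n / 3 ^ t"
proof -
  obtain q p where qp: "q > 0" "1 < (2::real) ^ q / 3 ^ p" "(2::real) ^ q / 3 ^ p < 1 + min 1 (\<delta> / 6)"
    using two_pow_over_three_pow_close_to_1[of "min 1 (\<delta> / 6)"] \<delta> by auto
  define s where "s = (2::real) ^ q / 3 ^ p"
  have s: "1 < s" "s < 2" "s < 1 + \<delta> / 6" using qp by (auto simp: s_def)
  obtain M where M: "9 < s ^ M" using real_arch_pow[OF s(1)] by blast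
  have "\<exists>n\<in>{1..M * q}. \<forall>t. 2 \<le> x * 2 ^ n / 3 ^ t \<longrightarrow> x * 2 ^ n / 3 ^ t \<le> 6 \<longrightarrow>
    6 - \<delta> < x * 2 ^ n / 3 ^ t" if x: "2 \<le> x" "x \<le> 6" for x
  proof -
    define m where "m = (LEAST m. 18 \<le> x * s ^ (m + 1))"
    have Mpos: "M > 0" using M by (cases M) auto
    have "18 \<le> x * s ^ M" using x M mult_mono[of 2 x 9 "s ^ M"] by simp
    then have ex: "18 \<le> x * s ^ (M - 1 + 1)" using Mpos by simp
    then have m1: "18 \<le> x * s ^ (m + 1)" unfolding m_def by (rule LeastI)
    have mM: "m \<le> M - 1" unfolding m_def by (rule Least_le) (rule ex)
    have m0: "m > 0"
    proof (rule ccontr)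
      assume "\<not> m > 0"
      then have "18 \<le> x * s" using m1 by simp
      also have "x * s \<le> 6 * s" using x s by simp
      finally show False using s by simp
    qed
    have m2: "x * s ^ m < 18"
    proof (rule ccontr)
      assume "\<not> ?thesis"
      then have "m \<le> m - 1" using m0 unfolding m_def by (intro Least_le) simp
      then show False using m0 by simp
    qed
    define v where "v = x * s ^ m"
    have "18 / s \<le> v" using m1 s by (simp add: v_def field_simps)
    have eq: "x * 2 ^ (m * q) = v * 3 ^ (p * m)"
      by (simp add: v_def s_def power_divide power_mult mult.commute[of m q])
    show ?thesis
    proof (intro bexI[of _ "m * q"] allI impI)
      fix t assume t: "2 \<le> x * 2 ^ (m * q) / 3 ^ t" "x * 2 ^ (m * q) / 3 ^ t \<le> 6"
      have "9 < 18 / s" using s by (simp add: field_simps)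
      then have v9: "9 < v" using \<open>18 / s \<le> v\<close> by simp
      \<comment> \<open>other powers of 3 take \<open>v\<close>, which lies between 9 and 18, out of \<open>[2, 6]\<close>\<close>
      have "t = p * m + 1"
      proof (rule antisym)
        show "t \<le> p * m + 1"
        proof (rule ccontr)
          assume "\<not> ?thesis"
          then have "(3::real) ^ (p * m + 2) \<le> 3 ^ t" by (intro power_increasing) auto
          then have "v * 3 ^ (p * m) / 3 ^ t \<le> v * 3 ^ (p * m) / 3 ^ (p * m + 2)"
            using v9 by (intro divide_left_mono) auto
          also have "\<dots> = v / 9" by (simp add: power_add)
          also have "\<dots> < 2" using m2 by (simp add: v_def)
          finally show False using t eq by simp
        qed
        show "p * m + 1 \<le> t"
        proof (rule ccontr)
          assume "\<not> ?thesis"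
          then have "(3::real) ^ t \<le> 3 ^ (p * m)" by (intro power_increasing) auto
          then have "v * 3 ^ (p * m) / 3 ^ (p * m) \<le> v * 3 ^ (p * m) / 3 ^ t"
            using v9 by (intro divide_left_mono) auto
          then show False using t eq v9 by simp
        qed
      qed
      then have val: "x * 2 ^ (m * q) / 3 ^ t = v / 3" by (simp add: eq)
      have "(6 - \<delta>) * s < 6"
      proof (cases "\<delta> < 6")
        case True
        then have "(6 - \<delta>) * s < (6 - \<delta>) * (1 + \<delta> / 6)" using s by simp
        also have "\<dots> = 6 - \<delta> * \<delta> / 6" by (simp add: field_simps)
        also have "\<dots> < 6" using \<delta> by simp
        finally show ?thesis .
      next
        case False
        then have "(6 - \<delta>) * s \<le> 0" using s by (simp add: mult_nonpos_nonneg)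
        then show ?thesis by linarith
      qed
      then have "6 - \<delta> < 6 / s" using s by (simp add: field_simps)
      then show "6 - \<delta> < x * 2 ^ (m * q) / 3 ^ t"
        using \<open>18 / s \<le> v\<close> unfolding val by simp
    next
      have "m * q \<le> M * q" using mM by (intro mult_right_mono) auto
      then show "m * q \<in> {1..M * q}" using m0 qp(1) by auto
    qed
  qed
  then show ?thesis using that by blast
qed

definition active_rows :: "(int \<Rightarrow> phase) \<Rightarrow> int \<Rightarrow> int \<Rightarrow> int set" where
  "active_rows \<phi> c d = {j \<in> {c..<d}. \<phi> j \<noteq> Wait}"

lemma finite_active_rows [simp]: "finite (active_rows \<phi> c d)"
  by (rule finite_subset[of _ "{c..<d}"]) (auto simp: active_rows_def)

lemma card_active_rows_Suc:
  assumes "c \<le> d"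
  shows "card (active_rows \<phi> c (d + 1)) = card (active_rows \<phi> c d) + (if \<phi> d = Wait then 0 else 1)"
proof -
  have "active_rows \<phi> c (d + 1) = active_rows \<phi> c d \<union> (if \<phi> d = Wait then {} else {d})"
    using assms by (auto simp: active_rows_def order_le_less)
  moreover have "d \<notin> active_rows \<phi> c d" by (simp add: active_rows_def)
  ultimately show ?thesis by auto
qed

text \<open>Only free rows change \<open>X\<close>, each by a factor 2 and possibly by a factor \<open>1/3\<close>. The number of
  factors \<open>1/3\<close> is left open: it is determined by \<open>X\<close> staying in \<open>[2, 6]\<close>, except at the endpoints.\<close>
lemma orbit_value:
  assumes "orbit \<phi> X Y"
  shows "\<exists>t. X (c + int i) = X c * 2 ^ card (active_rows \<phi> c (c + int i)) / 3 ^ t"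
proof (induction i)
  case 0
  then show ?case by (intro exI[of _ 0]) (simp add: active_rows_def)
next
  case (Suc i)
  then obtain t where t: "X (c + int i) = X c * 2 ^ card (active_rows \<phi> c (c + int i)) / 3 ^ t" ..
  define j where "j = c + int i"
  have j: "c + int (Suc i) = j + 1" "c \<le> j" by (simp_all add: j_def)
  have t: "X j = X c * 2 ^ card (active_rows \<phi> c j) / 3 ^ t" using t by (simp add: j_def)
  have "\<exists>t. X (j + 1) = X c * 2 ^ card (active_rows \<phi> c (j + 1)) / 3 ^ t"
  proof (cases "\<phi> j")
    case Wait
    then show ?thesis using orbit_Wait[OF assms] t by (intro exI[of _ t]) (simp add: card_active_rows_Suc[OF j(2)])
  next
    case Double
    then show ?thesis using orbit_Double[OF assms] t by (intro exI[of _ t]) (simp add: card_active_rows_Suc[OF j(2)])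
  next
    case Shrink
    then have "X (j + 1) = 2 * X j / 3" using orbit_Shrink[OF assms] by blast
    then show ?thesis using Shrink t by (intro exI[of _ "t + 1"]) (simp add: card_active_rows_Suc[OF j(2)])
  qed
  then show ?case unfolding j(1) .
qed

text \<open>A free row needs \<open>Y \<ge> 1\<close>, which takes more than \<open>r\<close> doublings to reach.\<close>
lemma waits_if_Y_small:
  assumes "orbit \<phi> X Y" "Y j < 1 / 2 ^ r" "i < r"
  shows "\<phi> (j + int i) = Wait"
proof -
  have "Y (j + int i) = 2 ^ i * Y j \<and> \<phi> (j + int i) = Wait" if "i < r" for i
    using that
  proof (induction i)
    case 0
    have "1 / 2 ^ r \<le> (1::real)" by simp
    then have "Y j < 1" using assms(2) by linarith
    then show ?case using orbit_active[OF assms(1), of j] by fastforce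
  next
    case (Suc i)
    then have Y: "Y (j + int i) = 2 ^ i * Y j" and "\<phi> (j + int i) = Wait" by auto
    then have "Y (j + int i + 1) = 2 * Y (j + int i)"
      using orbit_Wait[OF assms(1)] by blast
    then have Y': "Y (j + int (Suc i)) = 2 ^ Suc i * Y j" using Y by (simp add: add_ac)
    also have "\<dots> < 2 ^ Suc i * (1 / 2 ^ r)" using assms(2) by (intro mult_strict_left_mono) auto
    also have "\<dots> \<le> 1" using power_increasing[of "Suc i" r "2::real"] Suc.prems by simp
    finally have "Y (j + int (Suc i)) < 1" .
    then have "\<phi> (j + int (Suc i)) = Wait"
      using orbit_active[OF assms(1), of "j + int (Suc i)"] by fastforce
    then show ?case using Y' by blast
  qed
  then show ?thesis using assms(3) by blast
qed

text \<open>Among \<open>K\<close> free rows there is one after which \<open>X\<close> is within \<open>1 / 2 ^ r\<close> of 6; the value \<open>6 - X\<close>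
  then becomes \<open>Y\<close>. The bound \<open>K\<close> depends on \<open>r\<close> only, so the lemma applies to free rows above as well
  as below a given row.\<close>
lemma long_wait_after_many_active_rows:
  obtains K :: nat where "\<And>\<phi> X Y c d. orbit \<phi> X Y \<Longrightarrow> K \<le> card (active_rows \<phi> c d) \<Longrightarrow>
      \<exists>j\<in>{c..<d}. \<forall>i\<in>{j + 1..j + int r}. \<phi> i = Wait"
proof -
  obtain K :: nat where K: "\<And>x::real. 2 \<le> x \<Longrightarrow> x \<le> 6 \<Longrightarrow> \<exists>n\<in>{1..K}. \<forall>t.
    2 \<le> x * 2 ^ n / 3 ^ t \<longrightarrow> x * 2 ^ n / 3 ^ t \<le> 6 \<longrightarrow>
    6 - 1 / 2 ^ r < x * 2 ^ n / 3 ^ t"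
    using multiples_come_close_to_6[of "1 / 2 ^ r"] by auto
  have "\<exists>j\<in>{c..<d}. \<forall>i\<in>{j + 1..j + int r}. \<phi> i = Wait"
    if orb: "orbit \<phi> X Y" and card: "K \<le> card (active_rows \<phi> c d)" for \<phi> X Y c d
  proof -
    note X = orbit_bounds[OF orb]
    obtain n where n: "1 \<le> n" "n \<le> K"
      and close: "\<And>t. 2 \<le> X c * 2 ^ n / 3 ^ t \<Longrightarrow> X c * 2 ^ n / 3 ^ t \<le> 6 \<Longrightarrow>
        6 - 1 / 2 ^ r < X c * 2 ^ n / 3 ^ t"
      using K[OF X] by force
    \<comment> \<open>the row just above the \<open>n\<close>-th free row from \<open>c\<close> on\<close>
    define i where "i = (LEAST i. n \<le> card (active_rows \<phi> c (c + int i)))"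
    have "active_rows \<phi> c d \<noteq> {}" using card n by auto
    then have "c < d" by (auto simp: active_rows_def)
    then have ex: "n \<le> card (active_rows \<phi> c (c + int (nat (d - c))))" using card n by simp
    have i: "n \<le> card (active_rows \<phi> c (c + int i))" "i \<le> nat (d - c)"
      unfolding i_def by (rule LeastI[of _ "nat (d - c)"], rule ex) (rule Least_le, rule ex)
    have "i \<noteq> 0"
    proof
      assume "i = 0"
      then have "active_rows \<phi> c (c + int i) = {}" by (simp add: active_rows_def)
      then show False using i(1) n(1) by simp
    qed
    then obtain i' where i': "i = Suc i'" by (cases i) auto
    define j where "j = c + int i'"
    have j: "c + int i = j + 1" "c \<le> j" "j < d" using i(2) \<open>c < d\<close> by (auto simp: j_def i')
    have "\<not> n \<le> card (active_rows \<phi> c j)"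
      unfolding j_def by (rule not_less_Least) (simp add: i_def[symmetric] i')
    then have "card (active_rows \<phi> c (j + 1)) = n \<and> \<phi> j \<noteq> Wait"
      using i(1) card_active_rows_Suc[OF j(2), of \<phi>] unfolding j(1) by (auto split: if_splits)
    then have card_n: "card (active_rows \<phi> c (c + int i)) = n" and act: "\<phi> j \<noteq> Wait"
      using j(1) by auto
    from orbit_value[OF orb, of c i] have "6 - 1 / 2 ^ r < X (c + int i)"
      using close X[of "c + int i"] unfolding card_n by force
    moreover have "Y (j + 1) = 6 - X (j + 1)"
      using orbit_active[OF orb act] by blast
    ultimately have "Y (j + 1) < 1 / 2 ^ r" using j(1) by simp
    note wait = waits_if_Y_small[OF orb this]
    have "\<phi> k = Wait" if "k \<in> {j + 1..j + int r}" for k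
      using wait[of "nat (k - j - 1)"] that by auto
    then show ?thesis using j by (intro bexI[of _ j]) auto
  qed
  then show ?thesis using that by blast
qed

text \<open>On either side of \<open>b\<close> there are two possibilities: finitely many free rows, and then a whole
  half-plane is blank, or infinitely many, and then the previous lemma finds a long wait among them.\<close>
lemma long_waits_around_active_row:
  assumes orb: "orbit \<phi> X Y" and act: "\<phi> b \<noteq> Wait"
  shows "\<exists>a. a + int r \<le> b \<and> (\<forall>j\<in>{a..<a + int r}. \<phi> j = Wait)"
    and "\<exists>c>b. \<forall>j\<in>{c..<c + int r}. \<phi> j = Wait"
proof -
  obtain K :: nat where K: "\<And>c d. K \<le> card (active_rows \<phi> c d) \<Longrightarrow>
      \<exists>j\<in>{c..<d}. \<forall>i\<in>{j + 1..j + int r}. \<phi> i = Wait"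
    using long_wait_after_many_active_rows[of r] orb by metis
  show "\<exists>a. a + int r \<le> b \<and> (\<forall>j\<in>{a..<a + int r}. \<phi> j = Wait)"
  proof (cases "finite {j. j < b \<and> \<phi> j \<noteq> Wait}")
    case True
    define m where "m = Min (insert b {j. j < b \<and> \<phi> j \<noteq> Wait})"
    have "m \<le> b" "\<And>j. j < b \<Longrightarrow> \<phi> j \<noteq> Wait \<Longrightarrow> m \<le> j" using True by (auto simp: m_def)
    then show ?thesis by (intro exI[of _ "m - int r"]) force
  next
    case False
    then obtain F where F: "finite F" "card F = Suc K" "F \<subseteq> {j. j < b \<and> \<phi> j \<noteq> Wait}"
      using infinite_arbitrarily_large by metis
    have "F \<subseteq> active_rows \<phi> (Min F) b" using F by (auto simp: active_rows_def)
    then have "Suc K \<le> card (active_rows \<phi> (Min F) b)" using F(2) card_mono[OF finite_active_rows] by metis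
    then obtain j where j: "j < b" "\<forall>i\<in>{j + 1..j + int r}. \<phi> i = Wait"
      using K[of "Min F" b] by auto
    then have "j + int r < b" using act by (meson atLeastAtMost_iff not_less zless_add1_eq add1_zle_eq)
    then show ?thesis using j(2) by (intro exI[of _ "j + 1"]) auto
  qed
  show "\<exists>c>b. \<forall>j\<in>{c..<c + int r}. \<phi> j = Wait"
  proof (cases "finite {j. b < j \<and> \<phi> j \<noteq> Wait}")
    case True
    define m where "m = Max (insert b {j. b < j \<and> \<phi> j \<noteq> Wait})"
    have "b \<le> m" "\<And>j. b < j \<Longrightarrow> \<phi> j \<noteq> Wait \<Longrightarrow> j \<le> m" using True by (auto simp: m_def)
    then show ?thesis by (intro exI[of _ "m + 1"]) force
  next
    case False
    then obtain F where F: "finite F" "card F = Suc K" "F \<subseteq> {j. b < j \<and> \<phi> j \<noteq> Wait}"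
      using infinite_arbitrarily_large by metis
    have "j \<le> Max F" if "j \<in> F" for j using F(1) that by simp
    then have "F \<subseteq> active_rows \<phi> b (Max F + 1)" using F(3) by (force simp: active_rows_def)
    then have "Suc K \<le> card (active_rows \<phi> b (Max F + 1))" using F(2) card_mono[OF finite_active_rows] by metis
    then obtain j where j: "b \<le> j" "\<forall>i\<in>{j + 1..j + int r}. \<phi> i = Wait"
      using K[of b "Max F + 1"] by auto
    then show ?thesis by (intro exI[of _ "j + 1"]) auto
  qed
qed

section \<open>Subsystems of finite type\<close>

lemma striped_shift_blank_row_iff:
  assumes "w = (\<lambda>h. symbol (x h))" "x \<in> tilings"
  shows "w (i, j) = 0 \<longleftrightarrow> phase (x (0, j)) = Wait"
proof -
  have "x (i, j) \<in> tiles" using assms(2) by (simp add: tilings_def)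
  then have "w (i, j) = 0 \<longleftrightarrow> phase (x (i, j)) = Wait"
    by (auto simp: assms(1) symbol_def tiles_def)
  then show ?thesis using phase_constant_on_rows[OF assms(2), of i j] by simp
qed

lemma zero_strips_around_nonzero_symbol:
  assumes w: "w \<in> striped_shift" and nz: "w (i, b) \<noteq> 0"
  obtains a c where "a + int r \<le> b" "b < c"
    "\<And>k j. j \<in> {a..<a + int r} \<Longrightarrow> w (k, j) = 0"
    "\<And>k j. j \<in> {c..<c + int r} \<Longrightarrow> w (k, j) = 0"
proof -
  obtain x where x: "w = (\<lambda>h. symbol (x h))" "x \<in> tilings" using w by (auto simp: striped_shift_def)
  obtain X Y where orb: "orbit (\<lambda>j. phase (x (0, j))) X Y" using orbit_of_tiling[OF x(2)] .
  have "phase (x (0, b)) \<noteq> Wait" using nz striped_shift_blank_row_iff[OF x, of i b] by simp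
  from long_waits_around_active_row[OF orb this, of r] show ?thesis
    using that striped_shift_blank_row_iff[OF x] by metis
qed

text \<open>What is used of finite type: a configuration is admitted as soon as every horizontal strip of a
  certain height looks like a strip of some admitted configuration.\<close>
lemma SFT_window:
  assumes "SFT A Z"
  obtains r :: nat where "\<And>y. y \<in> topspace (full_shift A) \<Longrightarrow>
      (\<And>s. \<exists>z\<in>Z. \<exists>s'. \<forall>i. \<forall>t\<in>{0..int r}. y (i, s + t) = z (i, s' + t)) \<Longrightarrow> y \<in> Z"
proof -
  obtain P where P: "finite P" "\<forall>p\<in>P. pattern A p"
    "Z = {x \<in> topspace (full_shift A). \<forall>p\<in>P. \<not> occurs_in p x}"
    using assms by (auto simp: SFT_def)
  define H where "H = insert 0 (snd ` (\<Union>p\<in>P. dom p))"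
  have H: "finite H" using P by (auto simp: H_def pattern_def)
  define lo hi where "lo = Min H" and "hi = Max H"
  have range: "lo \<le> snd h" "snd h \<le> hi" if "p \<in> P" "h \<in> dom p" for p h
    using that H by (auto simp: lo_def hi_def H_def intro!: Min_le Max_ge)
  have "y \<in> Z" if y: "y \<in> topspace (full_shift A)"
    and win: "\<And>s. \<exists>z\<in>Z. \<exists>s'. \<forall>i. \<forall>t\<in>{0..int (nat (hi - lo))}. y (i, s + t) = z (i, s' + t)" for y
  proof -
    have "\<not> occurs_in p y" if p: "p \<in> P" for p
    proof
      assume "occurs_in p y"
      then obtain g where g: "\<And>h. h \<in> dom p \<Longrightarrow> p h = Some (y (h + g))"
        by (auto simp: occurs_in_iff)
      from win[of "lo + snd g"] obtain z s'
        where z: "z \<in> Z" "\<And>i t. t \<in> {0..int (nat (hi - lo))} \<Longrightarrow> y (i, lo + snd g + t) = z (i, s' + t)"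
        by blast
      have "p h = Some (z (h + (fst g, s' - lo)))" if h: "h \<in> dom p" for h
      proof -
        have "y (h + g) = y (fst h + fst g, lo + snd g + (snd h - lo))" by (simp add: plus_prod_def algebra_simps)
        also have "\<dots> = z (fst h + fst g, s' + (snd h - lo))"
          using range[OF p h] by (intro z(2)) auto
        also have "\<dots> = z (h + (fst g, s' - lo))" by (simp add: plus_prod_def algebra_simps)
        finally show ?thesis using g[OF h] by simp
      qed
      then have "occurs_in p z" unfolding occurs_in_iff by blast
      then show False using z(1) p by (simp add: P(3))
    qed
    then show ?thesis using y by (simp add: P(3))
  qed
  then show ?thesis using that by blast
qed

text \<open>The configuration \<open>y\<close> repeats the rows \<open>a, \<dots>, c - 1\<close> of \<open>z\<close> with period \<open>p = c - a\<close>. A strip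
  of \<open>y\<close> that starts at a row congruent to \<open>s'\<close> in \<open>[a, c)\<close> agrees with the strip of \<open>z\<close> at \<open>s'\<close>: beyond
  row \<open>c\<close> the former shows rows of \<open>z\<close> from \<open>a\<close> on, the latter rows from \<open>c\<close> on, and both are blank.\<close>
lemma SFT_subsystem_trivial:
  assumes "SFT A Z" "Z \<subseteq> striped_shift" "z \<in> Z"
  shows "z = (\<lambda>_. 0)"
proof (rule ccontr)
  assume "z \<noteq> (\<lambda>_. 0)"
  then obtain i b where nz: "z (i, b) \<noteq> 0" by (metis surj_pair)
  obtain r :: nat where r: "\<And>y. y \<in> topspace (full_shift A) \<Longrightarrow>
      (\<And>s. \<exists>z\<in>Z. \<exists>s'. \<forall>i. \<forall>t\<in>{0..int r}. y (i, s + t) = z (i, s' + t)) \<Longrightarrow> y \<in> Z"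
    using SFT_window[OF assms(1)] by blast
  obtain a c where ac: "a + int r \<le> b" "b < c"
    and low: "\<And>k j. j \<in> {a..<a + int r} \<Longrightarrow> z (k, j) = 0"
    and high: "\<And>k j. j \<in> {c..<c + int r} \<Longrightarrow> z (k, j) = 0"
    using zero_strips_around_nonzero_symbol[of z i b r] assms nz by blast
  define p where "p = c - a"
  have p: "p > 0" using ac by (simp add: p_def)
  define y where "y h = z (fst h, a + (snd h - a) mod p)" for h
  have "z h \<in> A" for h
    using assms(1,3) by (auto simp: SFT_def topspace_full_shift)
  then have "y \<in> topspace (full_shift A)" by (simp add: topspace_full_shift y_def)
  then have "y \<in> Z"
  proof (rule r)
    fix s
    define s' where "s' = a + (s - a) mod p"
    have s': "a \<le> s'" "s' < c"
      using pos_mod_bound[OF p, of "s - a"] pos_mod_sign[OF p, of "s - a"] unfolding s'_def p_def by linarith+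
    have "y (i, s + t) = z (i, s' + t)" if t: "t \<in> {0..int r}" for i t
    proof -
      have ys: "y (i, s + t) = z (i, a + (s' + t - a) mod p)"
        by (simp add: y_def s'_def mod_simps algebra_simps)
      show ?thesis
      proof (cases "s' + t < c")
        case True
        then have "(s' + t - a) mod p = s' + t - a" using s' t by (intro mod_pos_pos_trivial) (auto simp: p_def)
        then show ?thesis using ys by simp
      next
        case False
        have le: "s' + t < c + int r" using s' t by auto
        have "(s' + t - a) mod p = (s' + t - c) mod p"
          using mod_add_self2[of "s' + t - c" p] by (simp add: p_def algebra_simps)
        also have "\<dots> = s' + t - c"
          using False le ac by (intro mod_pos_pos_trivial) (auto simp: p_def)
        finally have "y (i, s + t) = z (i, a + (s' + t - c))" using ys by simp
        also have "\<dots> = 0" using False le by (intro low) auto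
        also have "\<dots> = z (i, s' + t)" using False le by (intro high[symmetric]) auto
        finally show ?thesis .
      qed
    qed
    then show "\<exists>z\<in>Z. \<exists>s'. \<forall>i. \<forall>t\<in>{0..int r}. y (i, s + t) = z (i, s' + t)"
      using assms(3) by blast
  qed
  then have "y \<in> striped_shift" using assms(2) by blast
  moreover have "y (i, b) = z (i, b)"
  proof -
    have "(b - a) mod p = b - a" using ac by (intro mod_pos_pos_trivial) (auto simp: p_def)
    then show ?thesis by (simp add: y_def)
  qed
  ultimately obtain a' where a': "\<And>j. j \<in> {a'..<a' + int (nat p)} \<Longrightarrow> y (i, j) = 0"
    using zero_strips_around_nonzero_symbol[of y i b "nat p"] nz by metis
  \<comment> \<open>a blank strip of thickness \<open>p\<close> contains a row congruent to \<open>b\<close>\<close>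
  define j where "j = a' + (b - a') mod p"
  have "j \<in> {a'..<a' + int (nat p)}" using p by (simp add: j_def)
  moreover have "y (i, j) = y (i, b)"
  proof -
    have "(j - a) mod p = ((b - a') mod p + (a' - a)) mod p" by (simp add: j_def algebra_simps)
    also have "\<dots> = (b - a) mod p" by (subst mod_add_left_eq) simp
    finally have "(j - a) mod p = (b - a) mod p" .
    then show ?thesis by (simp add: y_def)
  qed
  ultimately show False using a' \<open>y (i, b) = z (i, b)\<close> nz by metis
qed

section \<open>Every orbit is carried by tilings\<close>

lemma floor_diff_ge:
  fixes a :: int and i :: int
  assumes "of_int a \<le> (z::real)"
  shows "a \<le> \<lfloor>of_int (i + 1) * z\<rfloor> - \<lfloor>of_int i * z\<rfloor>"
proof -
  have "\<lfloor>of_int i * z\<rfloor> + a = \<lfloor>of_int i * z + of_int a\<rfloor>" by simp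
  also have "\<dots> \<le> \<lfloor>of_int (i + 1) * z\<rfloor>" using assms by (intro floor_mono) (simp add: algebra_simps)
  finally show ?thesis by simp
qed

lemma floor_diff_le:
  fixes a :: int and i :: int
  assumes "(z::real) \<le> of_int a"
  shows "\<lfloor>of_int (i + 1) * z\<rfloor> - \<lfloor>of_int i * z\<rfloor> \<le> a"
proof -
  have "\<lfloor>of_int (i + 1) * z\<rfloor> \<le> \<lfloor>of_int i * z + of_int a\<rfloor>"
    using assms by (intro floor_mono) (simp add: algebra_simps)
  then show ?thesis by simp
qed

text \<open>The digits are the differences of the Beatty sequences \<open>\<lfloor>i * X j\<rfloor>\<close>. Each carry is the same
  combination of floors as the corresponding relation of the reals, and it is bounded because the
  combination without floors vanishes; for instance \<open>3 * \<lfloor>a\<rfloor> - 2 * \<lfloor>b\<rfloor>\<close> lies strictly between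
  \<open>-3\<close> and \<open>3\<close> if \<open>3 * a = 2 * b\<close>.\<close>
lemma tiling_of_orbit:
  assumes orb: "orbit \<phi> X Y" and col: "\<And>h. col h \<in> {1, 2}"
  shows "(\<lambda>h. if \<phi> (snd h) = Wait then 0 else col h) \<in> striped_shift"
proof -
  define B where "B z i = \<lfloor>of_int i * z\<rfloor>" for z :: real and i :: int
  define x where "x h = (let i = fst h; j = snd h in
     Tile (\<phi> j) (col h) (B (X j) (i + 1) - B (X j) i) (B (Y j) (i + 1) - B (Y j) i)
       (case \<phi> j of
          Wait \<Rightarrow> B (X (j + 1)) i - B (X j) i
        | Double \<Rightarrow> B (X (j + 1)) i - 2 * B (X j) i
        | Shrink \<Rightarrow> 3 * B (X (j + 1)) i - 2 * B (X j) i)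
       (case \<phi> j of
          Wait \<Rightarrow> B (Y (j + 1)) i - 2 * B (Y j) i
        | _ \<Rightarrow> B (Y (j + 1)) i + B (X (j + 1)) i - 6 * i))" for h
  note O = spec[OF orb[unfolded orbit_def]]
  have digit: "a \<le> B z (i + 1) - B z i" if "of_int a \<le> z" for a z i
    unfolding B_def using floor_diff_ge[OF that] .
  have digit': "B z (i + 1) - B z i \<le> a" if "z \<le> of_int a" for a z i
    unfolding B_def using floor_diff_le[OF that] .
  have Bz: "real_of_int (B z i) \<le> of_int i * z" "of_int i * z < real_of_int (B z i) + 1" for z i
    unfolding B_def by linarith+
  have "x (i, j) \<in> tiles" for i j
  proof -
    have "B (X j) (i + 1) - B (X j) i \<in> {2..6}" "B (Y j) (i + 1) - B (Y j) i \<in> {0..4}"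
      using O[of j] digit[where a = 2 and z = "X j" and i = i] digit'[where a = 6 and z = "X j" and i = i] digit[where a = 0 and z = "Y j" and i = i] digit'[where a = 4 and z = "Y j" and i = i]
      by auto
    note d = this
    show ?thesis
    proof (cases "\<phi> j")
      case Wait
      then have o: "Y j \<le> 1" "X (j + 1) = X j" "Y (j + 1) = 2 * Y j" using O[of j] by auto
      have "real_of_int i * Y (j + 1) = 2 * (of_int i * Y j)" by (simp add: o)
      then have "B (Y (j + 1)) i - 2 * B (Y j) i \<in> {-3..3}"
        using Bz[where z = "Y (j + 1)" and i = i] Bz[where z = "Y j" and i = i] unfolding atLeastAtMost_iff by linarith
      then show ?thesis using Wait d o col digit'[where a = 1 and z = "Y j" and i = i]
        by (simp add: x_def tiles_def)
    next
      case Double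
      then have o: "X j \<le> 3" "1 \<le> Y j" "X (j + 1) = 2 * X j" "Y (j + 1) = 6 - X (j + 1)" using O[of j] by auto
      have "real_of_int i * X (j + 1) = 2 * (of_int i * X j)" by (simp add: o)
      then have "B (X (j + 1)) i - 2 * B (X j) i \<in> {-3..3}"
        using Bz[where z = "X (j + 1)" and i = i] Bz[where z = "X j" and i = i] unfolding atLeastAtMost_iff by linarith
      moreover have "real_of_int i * Y (j + 1) = 6 * real_of_int i - real_of_int i * X (j + 1)"
        unfolding o(4) by (simp add: algebra_simps)
      then have "B (Y (j + 1)) i + B (X (j + 1)) i - 6 * i \<in> {-3..3}"
        using Bz[where z = "X (j + 1)" and i = i] Bz[where z = "Y (j + 1)" and i = i] unfolding atLeastAtMost_iff by linarith
      ultimately show ?thesis using Double d o col digit[where a = 1 and z = "Y j" and i = i] digit'[where a = 3 and z = "X j" and i = i]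
        by (simp add: x_def tiles_def)
    next
      case Shrink
      then have o: "3 \<le> X j" "1 \<le> Y j" "3 * X (j + 1) = 2 * X j" "Y (j + 1) = 6 - X (j + 1)" using O[of j] by auto
      have "3 * (real_of_int i * X (j + 1)) = 2 * (of_int i * X j)" using o(3) by simp
      then have "3 * B (X (j + 1)) i - 2 * B (X j) i \<in> {-3..3}"
        using Bz[where z = "X (j + 1)" and i = i] Bz[where z = "X j" and i = i] unfolding atLeastAtMost_iff by linarith
      moreover have "real_of_int i * Y (j + 1) = 6 * real_of_int i - real_of_int i * X (j + 1)"
        unfolding o(4) by (simp add: algebra_simps)
      then have "B (Y (j + 1)) i + B (X (j + 1)) i - 6 * i \<in> {-3..3}"
        using Bz[where z = "X (j + 1)" and i = i] Bz[where z = "Y (j + 1)" and i = i] unfolding atLeastAtMost_iff by linarith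
      ultimately show ?thesis using Shrink d o col digit[where a = 1 and z = "Y j" and i = i] digit[where a = 3 and z = "X j" and i = i]
        by (simp add: x_def tiles_def)
    qed
  qed
  moreover have "compatible (x (i, j)) (x ((i, j) + (1, 0))) (x ((i, j) + (0, 1)))" for i j
    by (cases "\<phi> j") (simp_all add: x_def compatible_def algebra_simps Let_def)
  ultimately have "x \<in> tilings" unfolding tilings_def by (simp add: split_paired_All)
  moreover have "(\<lambda>h. if \<phi> (snd h) = Wait then 0 else col h) = (\<lambda>h. symbol (x h))"
    by (intro ext) (simp add: x_def symbol_def Let_def)
  ultimately show ?thesis by (simp add: striped_shift_def)
qed

section \<open>Orbits with a positive density of active rows\<close>

text \<open>The \<open>k\<close>-th point of the rotation, translated back from the circle to the interval \<open>[2, 6)\<close>.\<close>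
definition rotated :: "real \<Rightarrow> nat \<Rightarrow> real" where
  "rotated u k = 2 * 3 powr frac (u + real k * log 3 2)"

lemma rotated_bounds: "2 \<le> rotated u k" "rotated u k < 6"
proof -
  have "3 powr frac (u + real k * log 3 2) < 3 powr (1::real)"
    by (intro powr_less_mono frac_lt_1) auto
  then show "rotated u k < 6" by (simp add: rotated_def)
  have "(3::real) powr 0 \<le> 3 powr frac (u + real k * log 3 2)" by (intro powr_mono) auto
  then show "2 \<le> rotated u k" by (simp add: rotated_def)
qed

text \<open>Doubling adds \<open>log 3 2\<close> to the exponent of 3, and the exponent passes 1 exactly when the doubled
  value reaches 6; taking the fractional part then removes a factor 3.\<close>
lemma rotated_Suc:
  "rotated u (Suc k) = (if rotated u k < 3 then 2 * rotated u k else 2 * rotated u k / 3)"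
proof -
  define f where "f = frac (u + real k * log 3 2)"
  have "0 < log 3 (2::real)" "log 3 (2::real) < 1" by auto
  then have fr: "frac (log 3 2 :: real) = log 3 2" by (simp add: frac_eq)
  have p: "3 powr (f + log 3 2) = 2 * 3 powr f" by (simp add: powr_add)
  have "frac (u + real (Suc k) * log 3 2) = frac ((u + real k * log 3 2) + log 3 2)"
    by (simp add: algebra_simps)
  then have eq: "frac (u + real (Suc k) * log 3 2) = (if f + log 3 2 < 1 then f + log 3 2 else f + log 3 2 - 1)"
    by (simp add: frac_add fr f_def)
  have iff: "f + log 3 2 < 1 \<longleftrightarrow> rotated u k < 3"
  proof -
    have "f + log 3 2 < 1 \<longleftrightarrow> (3::real) powr (f + log 3 2) < 3 powr 1"
      by (subst powr_less_cancel_iff) auto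
    then show ?thesis by (simp only: p) (simp add: rotated_def f_def)
  qed
  have "rotated u (Suc k) = 2 * 3 powr (if f + log 3 2 < 1 then f + log 3 2 else f + log 3 2 - 1)"
    by (simp only: rotated_def eq)
  also have "\<dots> = (if rotated u k < 3 then 2 * (2 * 3 powr f) else 2 * (2 * 3 powr f) / 3)"
    unfolding iff by (simp add: p powr_diff)
  also have "2 * 3 powr f = rotated u k" by (simp add: rotated_def f_def)
  finally show ?thesis by simp
qed

text \<open>By convexity \<open>3 powr f\<close> lies below its chord \<open>1 + 2 * f\<close> on \<open>[0, 1]\<close>.\<close>
lemma six_minus_rotated_ge: "4 * (1 - frac (u + real k * log 3 2)) \<le> 6 - rotated u k"
proof -
  define f where "f = frac (u + real k * log 3 2)"
  have "0 \<le> f" "f < 1" by (auto simp: f_def frac_lt_1)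
  then have "3 powr f * 1 powr (1 - f) \<le> f * 3 + (1 - f) * 1"
    by (intro Youngs_inequality_0) auto
  then show ?thesis by (simp add: rotated_def f_def[symmetric])
qed

text \<open>The number of free rows so far, which is the time of the rotation, together with the current \<open>Y\<close>.\<close>
primrec orbit_state :: "real \<Rightarrow> nat \<Rightarrow> nat \<times> real" where
  "orbit_state u 0 = (0, 1)"
| "orbit_state u (Suc n) = (if snd (orbit_state u n) < 1 then (fst (orbit_state u n), 2 * snd (orbit_state u n))
     else (Suc (fst (orbit_state u n)), 6 - rotated u (Suc (fst (orbit_state u n)))))"

text \<open>The forward orbit is continued downwards by waiting rows: halving \<open>Y\<close> forever is a valid past.\<close>
definition row_X :: "real \<Rightarrow> int \<Rightarrow> real" where
  "row_X u j = rotated u (fst (orbit_state u (nat j)))"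

definition row_Y :: "real \<Rightarrow> int \<Rightarrow> real" where
  "row_Y u j = (if j < 0 then 1 / 2 ^ nat (- j) else snd (orbit_state u (nat j)))"

definition row_phase :: "real \<Rightarrow> int \<Rightarrow> phase" where
  "row_phase u j = (if row_Y u j < 1 then Wait else if row_X u j < 3 then Double else Shrink)"

lemma orbit_state_bounds: "0 < snd (orbit_state u n)" "snd (orbit_state u n) \<le> 4"
proof (induction n)
  case (Suc n)
  {
    case 1
    then show ?case using Suc rotated_bounds(2)[of u] by simp
  next
    case 2
    then show ?case using Suc rotated_bounds(1)[of u "Suc (fst (orbit_state u n))"] by simp
  }
qed auto

lemma orbit_rows: "orbit (row_phase u) (row_X u) (row_Y u)"
  unfolding orbit_def
proof
  fix j
  have range: "2 \<le> row_X u j" "row_X u j \<le> 6"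
    using rotated_bounds[of u "fst (orbit_state u (nat j))"] by (simp_all add: row_X_def)
  show "2 \<le> row_X u j \<and> row_X u j \<le> 6 \<and> 0 \<le> row_Y u j \<and> row_Y u j \<le> 4 \<and>
     (case row_phase u j of
        Wait \<Rightarrow> row_Y u j \<le> 1 \<and> row_X u (j + 1) = row_X u j \<and> row_Y u (j + 1) = 2 * row_Y u j
      | Double \<Rightarrow> row_X u j \<le> 3 \<and> 1 \<le> row_Y u j \<and> row_X u (j + 1) = 2 * row_X u j \<and>
          row_Y u (j + 1) = 6 - row_X u (j + 1)
      | Shrink \<Rightarrow> 3 \<le> row_X u j \<and> 1 \<le> row_Y u j \<and> 3 * row_X u (j + 1) = 2 * row_X u j \<and>
          row_Y u (j + 1) = 6 - row_X u (j + 1))"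
  proof (cases "j < 0")
    case True
    define n where "n = nat (- j - 1)"
    have j: "j = - int (Suc n)" using True by (simp add: n_def)
    have Y: "row_Y u j = 1 / 2 ^ Suc n" by (simp add: row_Y_def n_def True flip: power_Suc) (use True in \<open>simp add: nat_diff_distrib Suc_nat_eq_nat_zadd1\<close>)
    have "1 / 2 ^ Suc n < (1::real)" by (simp add: field_simps one_less_power del: power_Suc)
    then have "row_phase u j = Wait" by (simp add: row_phase_def Y)
    moreover have "row_X u (j + 1) = row_X u j" by (simp add: row_X_def j)
    moreover have "row_Y u (j + 1) = 2 * row_Y u j"
      by (cases n) (simp_all add: row_Y_def j nat_add_distrib)
    moreover have "row_Y u j < 1" using \<open>1 / 2 ^ Suc n < (1::real)\<close> by (simp only: Y)
    moreover have "0 \<le> row_Y u j" by (simp add: Y)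
    ultimately show ?thesis using range by simp
  next
    case False
    then have "nat (j + 1) = Suc (nat j)" by simp
    then show ?thesis using False range orbit_state_bounds[of u "nat j"]
      by (auto simp: row_phase_def row_X_def row_Y_def rotated_Suc)
  qed
qed

lemma fst_orbit_state: "fst (orbit_state u n) = card (active_rows (row_phase u) 0 (int n))"
proof (induction n)
  case (Suc n)
  have "row_phase u (int n) = Wait \<longleftrightarrow> snd (orbit_state u n) < 1"
    by (simp add: row_phase_def row_Y_def)
  then show ?case using Suc card_active_rows_Suc[of 0 "int n" "row_phase u"] by (simp add: add.commute)
qed (simp add: active_rows_def)

text \<open>The potential \<open>4 / sqrt Y\<close> drops by at least 1 in each waiting row, as \<open>4 * (1 - 1 / sqrt 2) \<ge> 1\<close>,
  and is renewed in each free row. An inverse square root is used in place of the logarithm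
  because it is just as integrable and easier to estimate.\<close>
lemma waiting_time_bound:
  "real n - real (fst (orbit_state u n)) + 4 / sqrt (snd (orbit_state u n))
     \<le> 4 + (\<Sum>k = 1..fst (orbit_state u n). 4 / sqrt (6 - rotated u k))"
proof (induction n)
  case (Suc n)
  define y where "y = snd (orbit_state u n)"
  have y: "0 < y" using orbit_state_bounds by (simp add: y_def)
  show ?case
  proof (cases "y < 1")
    case True
    have "1 + 4 / sqrt (2 * y) \<le> 4 / sqrt y"
    proof -
      have s: "0 < sqrt y" "sqrt y \<le> 1" using y True by auto
      have "4 / 3 \<le> sqrt (2::real)" by (rule real_le_rsqrt) (simp add: power2_eq_square)
      then have "4 / sqrt (2 * y) \<le> 4 / (4 / 3 * sqrt y)"
        unfolding real_sqrt_mult using s by (intro divide_left_mono mult_right_mono) auto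
      also have "\<dots> = 4 / sqrt y - 1 / sqrt y" using s by (simp add: field_simps)
      finally have "4 / sqrt (2 * y) \<le> 4 / sqrt y - 1 / sqrt y" .
      moreover have "1 \<le> 1 / sqrt y" using s by simp
      ultimately show ?thesis by linarith
    qed
    then show ?thesis using Suc True by (simp add: y_def[symmetric])
  next
    case False
    have "0 \<le> 4 / sqrt y" using y by simp
    then have "real n - real (fst (orbit_state u n)) \<le> 4 + (\<Sum>k = 1..fst (orbit_state u n). 4 / sqrt (6 - rotated u k))"
      using Suc by (simp only: y_def[symmetric])
    then show ?thesis using False by (simp add: y_def[symmetric])
  qed
qed simp

text \<open>Each summand has integral 4 over \<open>u\<close> in \<open>[0, 1)\<close>. Splitting the circle at the point
  where \<open>u + c k\<close> wraps around bounds the integral by two shifted copies of the function, which costs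
  a factor 2 and gives at most \<open>8 * m\<close>. A sum that exceeded \<open>9 * m\<close> for all \<open>u\<close> would contradict this.\<close>
lemma exists_rotation_with_small_average:
  fixes c :: "nat \<Rightarrow> real"
  assumes "m > 0"
  shows "\<exists>u. (\<Sum>k = 1..m. 2 * (1 - frac (u + c k)) powr (- 1 / 2)) \<le> 9 * real m"
proof (rule ccontr)
  assume "\<not> ?thesis"
  then have big: "9 * real m < (\<Sum>k = 1..m. 2 * (1 - frac (u + c k)) powr (- 1 / 2))" for u
    by (auto simp: not_le)
  define H where "H x = ennreal (2 * x powr (- 1 / 2)) * indicator {0..1} x" for x :: real
  have H [measurable]: "H \<in> borel_measurable borel" unfolding H_def by measurable
  have int: "(\<integral>\<^sup>+x. H x \<partial>lborel) = 4"
  proof -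
    have "((\<lambda>x::real. 2 * x powr (- 1 / 2)) has_integral 2 * (1 powr (- 1 / 2 + 1) / (- 1 / 2 + 1))) {0..1}"
      by (intro has_integral_mult_right has_integral_powr_from_0) auto
    then have "(\<integral>\<^sup>+x. H x \<partial>lborel) = ennreal (2 * (1 powr (- 1 / 2 + 1) / (- 1 / 2 + 1)))"
      unfolding H_def by (intro nn_integral_has_integral_lebesgue') auto
    then show ?thesis by simp
  qed
  have shifted: "(\<integral>\<^sup>+u. H (a - u) \<partial>lborel) = 4" for a
    using nn_integral_real_affine[OF H, of "-1" a] by (simp add: int)
  have pt: "ennreal (2 * (1 - frac (u + d)) powr (- 1 / 2)) \<le> H (1 - frac d - u) + H (2 - frac d - u)"
    if "0 \<le> u" "u < 1" for u d
  proof -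
    have fru: "frac u = u" using that by (simp add: frac_eq)
    have "frac (u + d) = u + frac d \<or> frac (u + d) = u + frac d - 1"
      unfolding frac_add fru by auto
    then have shift: "1 - frac (u + d) = 1 - frac d - u \<or> 1 - frac (u + d) = 2 - frac d - u"
      by linarith
    have "0 \<le> 1 - frac (u + d)" "1 - frac (u + d) \<le> 1"
      using frac_lt_1[of "u + d"] by (auto simp: less_imp_le)
    then have "ennreal (2 * (1 - frac (u + d)) powr (- 1 / 2)) = H (1 - frac (u + d))"
      by (simp add: H_def)
    then show ?thesis using shift by (metis add_increasing add_increasing2 order_refl zero_le)
  qed
  have "ennreal (9 * real m) = (\<integral>\<^sup>+u. ennreal (9 * real m) * indicator {0..<1::real} u \<partial>lborel)"
    by (simp add: nn_integral_cmult_indicator)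
  also have "\<dots> \<le> (\<integral>\<^sup>+u. (\<Sum>k = 1..m. H (1 - frac (c k) - u) + H (2 - frac (c k) - u)) \<partial>lborel)"
  proof (intro nn_integral_mono)
    fix u :: real
    show "ennreal (9 * real m) * indicator {0..<1} u
        \<le> (\<Sum>k = 1..m. H (1 - frac (c k) - u) + H (2 - frac (c k) - u))"
    proof (cases "u \<in> {0..<1}")
      case True
      have "ennreal (9 * real m) \<le> ennreal (\<Sum>k = 1..m. 2 * (1 - frac (u + c k)) powr (- 1 / 2))"
        using big[of u] by (intro ennreal_leI) simp
      also have "\<dots> = (\<Sum>k = 1..m. ennreal (2 * (1 - frac (u + c k)) powr (- 1 / 2)))"
        by (rule sum_ennreal[symmetric]) simp
      also have "\<dots> \<le> (\<Sum>k = 1..m. H (1 - frac (c k) - u) + H (2 - frac (c k) - u))"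
        using True by (intro sum_mono pt) auto
      finally show ?thesis using True by simp
    qed simp
  qed
  also have "\<dots> = (\<Sum>k = 1..m. (\<integral>\<^sup>+u. H (1 - frac (c k) - u) \<partial>lborel) + (\<integral>\<^sup>+u. H (2 - frac (c k) - u) \<partial>lborel))"
    by (subst nn_integral_sum) (auto intro!: sum.cong nn_integral_add)
  also have "\<dots> = ennreal (8 * real m)"
    by (simp add: shifted ennreal_mult' flip: ennreal_numeral ennreal_plus) (simp add: ennreal_of_nat_eq_real_of_nat ennreal_mult'[symmetric] mult.commute)
  finally show False using assms by simp
qed

text \<open>If at most \<open>m = n div 20\<close> of the first \<open>n\<close> rows were free, the bounds on the waiting times would
  give \<open>n \<le> 10 * m + 4\<close>.\<close>
lemma exists_dense_orbit:
  assumes "n \<ge> 20"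
  obtains \<phi> X Y where "orbit \<phi> X Y" "real n / 20 \<le> real (card (active_rows \<phi> 0 (int n)))"
proof -
  define m where "m = n div 20"
  have m: "m > 0" using assms by (simp add: m_def)
  obtain u where u: "(\<Sum>k = 1..m. 2 * (1 - frac (u + real k * log 3 2)) powr (- 1 / 2)) \<le> 9 * real m"
    using exists_rotation_with_small_average[OF m, of "\<lambda>k. real k * log 3 2"] by blast
  have pos: "0 < 6 - rotated u k" for k using rotated_bounds(2)[of u k] by simp
  have le: "4 / sqrt (6 - rotated u k) \<le> 2 * (1 - frac (u + real k * log 3 2)) powr (- 1 / 2)" for k
  proof -
    define g where "g = 1 - frac (u + real k * log 3 2)"
    have g: "g > 0" by (simp add: g_def frac_lt_1)
    have "4 / sqrt (6 - rotated u k) \<le> 4 / sqrt (4 * g)"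
      using six_minus_rotated_ge[of u k] g by (intro divide_left_mono) (auto simp: g_def[symmetric] pos)
    also have "\<dots> = 2 / sqrt g" by (simp add: real_sqrt_mult)
    also have "\<dots> = 2 * g powr (- 1 / 2)"
      using g by (simp add: powr_minus_divide powr_half_sqrt)
    finally show ?thesis by (simp add: g_def)
  qed
  have "m < fst (orbit_state u n)"
  proof (rule ccontr)
    assume "\<not> ?thesis"
    then have k: "fst (orbit_state u n) \<le> m" by simp
    have "real n - real (fst (orbit_state u n)) \<le> real n - real (fst (orbit_state u n)) + 4 / sqrt (snd (orbit_state u n))"
      using orbit_state_bounds(1)[of u n] by simp
    also note waiting_time_bound
    also have "(\<Sum>k = 1..fst (orbit_state u n). 4 / sqrt (6 - rotated u k)) \<le> (\<Sum>k = 1..m. 4 / sqrt (6 - rotated u k))"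
      using k pos by (intro sum_mono2) (auto intro: less_imp_le)
    also have "\<dots> \<le> (\<Sum>k = 1..m. 2 * (1 - frac (u + real k * log 3 2)) powr (- 1 / 2))"
      by (intro sum_mono le)
    also note u
    finally have "real n \<le> 4 + 10 * real m" using k by simp
    moreover have "20 * m \<le> n" by (simp add: m_def)
    ultimately show False using assms by linarith
  qed
  moreover have "n < 20 * (m + 1)" by (simp add: m_def)
  moreover have "20 * (m + 1) \<le> 20 * fst (orbit_state u n)"
    using \<open>m < fst (orbit_state u n)\<close> by (intro mult_le_mono2) simp
  ultimately have "n \<le> 20 * fst (orbit_state u n)" by (meson less_imp_le le_trans)
  then have "real n / 20 \<le> real (fst (orbit_state u n))" by simp
  then show ?thesis using that[OF orbit_rows[of u]] by (simp add: fst_orbit_state)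
qed

text \<open>Above an orbit with at least \<open>n / 20\<close> free rows in the square, the colours of at least \<open>n * n / 20\<close>
  cells are independent of each other.\<close>
lemma card_patterns_on_striped_shift:
  assumes "n \<ge> 20"
  shows "ln 2 / 20 * real (n * n) \<le> ln (real (card (patterns_on (corner_square n) striped_shift)))"
proof -
  obtain \<phi> X Y where orb: "orbit \<phi> X Y"
    and dens: "real n / 20 \<le> real (card (active_rows \<phi> 0 (int n)))"
    using exists_dense_orbit[OF assms] .
  define J where "J = active_rows \<phi> 0 (int n)"
  define S where "S = {0..<int n} \<times> J"
  have J: "finite J" by (simp add: J_def)
  have S: "finite S" "card S = n * card J" using J by (simp_all add: S_def card_cartesian_product)
  define w :: "(int \<times> int) set \<Rightarrow> nat config"
    where "w Q h = (if \<phi> (snd h) = Wait then 0 else if h \<in> Q then 2 else 1)" for Q h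
  have "w Q \<in> striped_shift" for Q
    using tiling_of_orbit[OF orb, of "\<lambda>h. if h \<in> Q then 2 else 1"] by (simp add: w_def[abs_def])
  moreover have "shift (0, 0) (w Q) = w Q" for Q by (simp add: shift_def zero_prod_def[symmetric])
  ultimately have "restrict (w Q) (corner_square n) \<in> patterns_on (corner_square n) striped_shift" for Q
    unfolding patterns_on_def mem_Collect_eq by metis
  then have "(\<lambda>Q. restrict (w Q) (corner_square n)) ` Pow S \<subseteq> patterns_on (corner_square n) striped_shift" by blast
  moreover have "inj_on (\<lambda>Q. restrict (w Q) (corner_square n)) (Pow S)"
  proof (rule inj_onI)
    fix Q R assume QR: "Q \<in> Pow S" "R \<in> Pow S" and eq: "restrict (w Q) (corner_square n) = restrict (w R) (corner_square n)"
    have "h \<in> Q \<longleftrightarrow> h \<in> R" if "h \<in> S" for h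
    proof -
      have "h \<in> corner_square n" "\<phi> (snd h) \<noteq> Wait" using that by (auto simp: S_def J_def active_rows_def corner_square_def)
      then show ?thesis using fun_cong[OF eq, of h] by (auto simp: w_def split: if_splits)
    qed
    then show "Q = R" using QR by blast
  qed
  moreover have fin: "finite (patterns_on (corner_square n) striped_shift)"
  proof (rule finite_patterns_on)
    show "striped_shift \<subseteq> topspace (full_shift {0, 1, 2})"
      using sofic_striped_shift closedin_subset by (auto simp: sofic_def subshift_def)
  qed auto
  ultimately have "card (Pow S) \<le> card (patterns_on (corner_square n) striped_shift)" using card_inj_on_le by blast
  then have "2 ^ (n * card J) \<le> card (patterns_on (corner_square n) striped_shift)" using S by (simp add: card_Pow)
  then have "real (2 ^ (n * card J)) \<le> real (card (patterns_on (corner_square n) striped_shift))" by (rule of_nat_mono)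
  then have "ln (real (2 ^ (n * card J))) \<le> ln (real (card (patterns_on (corner_square n) striped_shift)))"
    by (subst ln_le_cancel_iff) (auto intro: less_le_trans[rotated])
  moreover have "ln (real (2 ^ (n * card J))) = real n * real (card J) * ln 2"
    by (simp add: ln_realpow)
  moreover have "real n * (real n / 20) * ln 2 \<le> real n * real (card J) * ln 2"
    using dens unfolding J_def[symmetric] by (intro mult_right_mono mult_left_mono) auto
  ultimately show ?thesis by (simp add: mult_ac)
qed

lemma zero_in_striped_shift: "(\<lambda>_. 0) \<in> striped_shift"
proof -
  have "orbit (\<lambda>_. Wait) (\<lambda>_. 2) (\<lambda>_. 0)" by (simp add: orbit_def)
  from tiling_of_orbit[OF this, of "\<lambda>_. 1"] show ?thesis by simp
qed

lemma SFT_zero: "SFT {0, 1, 2} {\<lambda>_. 0 :: nat}"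
  unfolding SFT_def
proof (intro conjI exI)
  let ?P = "(\<lambda>a. [(0, 0) \<mapsto> a]) ` {1, 2 :: nat} :: (int \<times> int \<rightharpoonup> nat) set"
  show "finite ?P" by simp
  show "\<forall>p\<in>?P. pattern {0, 1, 2} p" by (auto simp: pattern_def)
  have "occurs_in [(0, 0) \<mapsto> a] x \<longleftrightarrow> (\<exists>g. x g = a)" for a and x :: "nat config"
    unfolding occurs_in_iff by (auto simp: zero_prod_def[symmetric])
  then show "{\<lambda>_. 0 :: nat} = {x \<in> topspace (full_shift {0, 1, 2}). \<forall>p\<in>?P. \<not> occurs_in p x}"
    by (auto simp: topspace_full_shift fun_eq_iff)
qed simp

theorem proposition6p1:
  shows "\<exists>(A :: nat set) W. sofic A W \<and> W \<noteq> {} \<and> entropy W > 0 \<and>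
           (\<exists>x. {Z. subsystem A Z W \<and> SFT A Z \<and> Z \<noteq> {}} = {{x}})"
proof (intro exI conjI)
  show sofic: "sofic {0, 1, 2} striped_shift" by (rule sofic_striped_shift)
  show nonempty: "striped_shift \<noteq> {}" using zero_in_striped_shift by blast
  have "striped_shift \<subseteq> topspace (full_shift {0, 1, 2})"
    using sofic closedin_subset by (auto simp: sofic_def subshift_def)
  then have "ln 2 / 20 \<le> entropy striped_shift"
    using nonempty card_patterns_on_striped_shift by (intro entropy_ge) auto
  then show "entropy striped_shift > 0" by (rule less_le_trans[rotated]) simp
  have "Z = {\<lambda>_. 0}" if "Z \<subseteq> striped_shift" "SFT {0, 1, 2} Z" "Z \<noteq> {}" for Z
    using SFT_subsystem_trivial[OF that(2,1)] that(3) by blast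
  moreover have "subsystem {0, 1, 2} {\<lambda>_. 0} striped_shift"
    using subshift_SFT[OF SFT_zero] zero_in_striped_shift by (simp add: subsystem_def)
  ultimately show "{Z. subsystem {0, 1, 2} Z striped_shift \<and> SFT {0, 1, 2} Z \<and> Z \<noteq> {}} = {{\<lambda>_. 0}}"
    using SFT_zero by (auto simp: subsystem_def)
qed

end
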